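(* Fix $n,m\in\mathbb N$ and $\Gamma\in(0,\infty)$. Suppose that every map $f:\mathbb Z_{2m}^n\to\mathcal P_2(\mathbb R^3)$ satisfies \[ \left(\sum_{j=1}^n\sum_{x\in\mathbb Z_{2m}^n} W_2\bigl(f(x+me_j),f(x)\bigr)^2\right)^{1/2} \le \Gamma m\left(\frac1{2^n}\sum_{\varepsilon\in\{-1,1\}^n}\sum_{x\in\mathbb Z_{2m}^n} W_2\bigl(f(x+\varepsilon),f(x)\bigr)^2\right)^{1/2} \] (the metric cotype $2$ inequality with scaling parameter $m$ and constant $\Gamma$). Then \[ m\ge\frac n{\Gamma^2}. \] Consequently, for all $n,m\in\mathbb N$, \[ \mathsf K_{\mathrm{CBB}(0)}(n,m)\ge\frac nm . \]
   Context: $\mathbb N=\{1,2,3,\dots\}$. $(\mathcal P_2(\mathbb R^3),W_2)$ is the $2$-Wasserstein space of Borel probability measures on (Euclidean) $\mathbb R^3$ with finite second moment, with the $2$-Wasserstein distance $W_2$. Discrete torus: $\mathbb Z_{2m}=\mathbb Z/(2m\mathbb Z)$, $e_1,\dots,e_n$ are the standard basis vectors, and additions in $\mathbb Z_{2m}^n$ (such as $x+me_j$ and $x+\varepsilon$ with $\varepsilon\in\{-1,1\}^n$) are modulo $2m$ coordinatewise. Alexandrov spaces of nonnegative curvature: a complete geodesic metric space $(X,d_X)$ is an Alexandrov space of nonnegative curvature (a complete $\mathrm{CBB}(0)$ space) if for every $x,y,z\in X$ and every midpoint $w\in X$ of $x$ and $y$, i.e. $d_X(w,x)=d_X(w,y)=\frac12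 d_X(x,y)$, one has \[ d_X(z,w)^2+\tfrac14 d_X(x,y)^2\ \ge\ \tfrac12 d_X(z,x)^2+\tfrac12 d_X(z,y)^2 . \] For $n,m\in\mathbb N$, $\mathsf K_{\mathrm{CBB}(0)}(n,m)$ is the infimum of those real $K>0$ for which \[ \sum_{j=1}^n\sum_{x\in\mathbb Z_{2m}^n} d_X\bigl(f(x+me_j),f(x)\bigr)^2 \le K m^2\frac1{2^n}\sum_{\varepsilon\in\{-1,1\}^n}\sum_{x\in\mathbb Z_{2m}^n} d_X\bigl(f(x+\varepsilon),f(x)\bigr)^2 \] for every complete Alexandrov space $X$ of nonnegative curvature and every map $f:\mathbb Z_{2m}^n\to X$; the infimum of the empty set is $\infty$. *)

theory Defs
  imports
    "HOL-Probability.Probability"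
    "HOL-Library.Equipollence"
begin

subsection \<open>The 2-Wasserstein space\<close>

definition P2 :: "('a::euclidean_space) measure set" where
  "P2 = {\<mu>. sets \<mu> = sets borel \<and> prob_space \<mu> \<and> (\<integral>\<^sup>+x. ennreal ((norm x)^2) \<partial>\<mu>) < \<infinity>}"

definition couplings ::
    "('a::euclidean_space) measure \<Rightarrow> 'a measure \<Rightarrow> ('a \<times> 'a) measure set" where
  "couplings \<mu> \<nu> = {\<pi>. sets \<pi> = sets borel \<and> prob_space \<pi> \<and>
     distr \<pi> borel fst = \<mu> \<and> distr \<pi> borel snd = \<nu>}"

text \<open>For measures in \<^const>\<open>P2\<close> the infimum is finite, so that \<^const>\<open>enn2real\<close> loses nothing.\<close>

definition W2 :: "('a::euclidean_space) measure \<Rightarrow> 'a measure \<Rightarrow> real" where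
  "W2 \<mu> \<nu> = sqrt (enn2real
     (INF \<pi>\<in>couplings \<mu> \<nu>. \<integral>\<^sup>+z. ennreal ((dist (fst z) (snd z))^2) \<partial>\<pi>))"

subsection \<open>The discrete torus\<close>

text \<open>A point of the torus is given by its coordinates with indices in \<open>{1..n}\<close>, each
  represented by its residue in \<open>{0..<2 * m}\<close>; outside of \<open>{1..n}\<close> it is \<^const>\<open>undefined\<close>.\<close>

definition torus :: "nat \<Rightarrow> nat \<Rightarrow> (nat \<Rightarrow> int) set" where
  "torus n m = {1..n} \<rightarrow>\<^sub>E {0..<2 * int m}"

definition tadd :: "nat \<Rightarrow> nat \<Rightarrow> (nat \<Rightarrow> int) \<Rightarrow> (nat \<Rightarrow> int) \<Rightarrow> (nat \<Rightarrow> int)" where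
  "tadd n m x v = (\<lambda>i\<in>{1..n}. (x i + v i) mod (2 * int m))"

definition unit_vec :: "nat \<Rightarrow> nat \<Rightarrow> int" where
  "unit_vec j = (\<lambda>i. if i = j then 1 else 0)"

definition signs :: "nat \<Rightarrow> (nat \<Rightarrow> int) set" where
  "signs n = {1..n} \<rightarrow>\<^sub>E {-1, 1}"

definition antipodal_sum ::
    "nat \<Rightarrow> nat \<Rightarrow> ('x \<Rightarrow> 'x \<Rightarrow> real) \<Rightarrow> ((nat \<Rightarrow> int) \<Rightarrow> 'x) \<Rightarrow> real" where
  "antipodal_sum n m d f =
     (\<Sum>j\<in>{1..n}. \<Sum>x\<in>torus n m. (d (f (tadd n m x (\<lambda>i. int m * unit_vec j i))) (f x))^2)"

definition diagonal_average ::
    "nat \<Rightarrow> nat \<Rightarrow> ('x \<Rightarrow> 'x \<Rightarrow> real) \<Rightarrow> ((nat \<Rightarrow> int) \<Rightarrow> 'x) \<Rightarrow> real" where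
  "diagonal_average n m d f =
     1 / 2^n * (\<Sum>\<epsilon>\<in>signs n. \<Sum>x\<in>torus n m. (d (f (tadd n m x \<epsilon>)) (f x))^2)"

subsection \<open>Alexandrov spaces of nonnegative curvature\<close>

definition geodesic_space :: "'a set \<Rightarrow> ('a \<Rightarrow> 'a \<Rightarrow> real) \<Rightarrow> bool" where
  "geodesic_space X d \<longleftrightarrow> Metric_space X d \<and>
     (\<forall>x\<in>X. \<forall>y\<in>X. \<exists>\<gamma>\<in>{0..1::real} \<rightarrow> X. \<gamma> 0 = x \<and> \<gamma> 1 = y \<and>
        (\<forall>s\<in>{0..1}. \<forall>t\<in>{0..1}. d (\<gamma> s) (\<gamma> t) = \<bar>s - t\<bar> * d x y))"

definition complete_CBB0 :: "'a set \<Rightarrow> ('a \<Rightarrow> 'a \<Rightarrow> real) \<Rightarrow> bool" where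
  "complete_CBB0 X d \<longleftrightarrow> geodesic_space X d \<and> Metric_space.mcomplete X d \<and>
     (\<forall>x\<in>X. \<forall>y\<in>X. \<forall>z\<in>X. \<forall>w\<in>X.
        d w x = 1/2 * d x y \<and> d w y = 1/2 * d x y \<longrightarrow>
        (d z w)^2 + 1/4 * (d x y)^2 \<ge> 1/2 * (d z x)^2 + 1/2 * (d z y)^2)"

text \<open>The spaces range over all metric spaces whose points are drawn from the type \<^typ>\<open>'a\<close>. Every
  finite subset of a complete CBB(0) space lies in a complete CBB(0) subspace of cardinality at
  most the continuum (iterate \<open>\<omega>\<^sub>1\<close> times adjoining a geodesic for every pair of points and the
  limits of Cauchy sequences). Hence the value is the same for all types \<^typ>\<open>'a\<close> with at least
  continuum many elements, namely the constant for the class of all complete CBB(0) spaces.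
  For a smaller \<^typ>\<open>'a\<close> fewer spaces are tested and the value may be smaller.
  Note that \<open>Inf {} = \<infinity>\<close> in \<^typ>\<open>ereal\<close>.\<close>

definition K_CBB0 :: "'a itself \<Rightarrow> nat \<Rightarrow> nat \<Rightarrow> ereal" where
  "K_CBB0 (_ :: 'a itself) n m = Inf {ereal K | K. K > 0 \<and>
     (\<forall>(X :: 'a set) d f. complete_CBB0 X d \<and> f \<in> torus n m \<rightarrow> X \<longrightarrow>
        antipodal_sum n m d f \<le> K * (real m)^2 * diagonal_average n m d f)}"

end

theory Submission
  imports Defs
begin

text \<open>The idea is to map the torus to \<open>P2\<close> so that, after rescaling, \<open>W2\<^sup>2\<close> becomes the path metric of
  the graph \<open>G\<close> on the torus in which \<open>x\<close> is joined to all \<open>x + \<epsilon>\<close>, up to a factor \<open>1 + \<delta>\<close>. In this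
  graph \<open>x + \<epsilon>\<close> is at distance 1 from \<open>x\<close>, while \<open>x + m e\<^sub>j\<close> is at distance at least \<open>m\<close>: the circle
  norm of the displacement in the coordinate \<open>j\<close> changes by at most 1 along each edge. The left side
  of the squared cotype inequality is then at least \<open>n m\<close> and the right side at most \<open>\<Gamma>\<^sup>2 m\<^sup>2 (1 + \<delta>)\<close>
  per torus point, whence \<open>n \<le> \<Gamma>\<^sup>2 m (1 + \<delta>)\<close> for each \<open>\<delta> > 0\<close>.

  Such a map exists because squared distances make short steps cheap. The vertices of \<open>G\<close> are placed
  on the moment curve in three-space and the edges become segments; a segment of squared length \<open>\<ell>\<close>
  is filled with equally spaced points that divide it into \<open>R \<ell>\<close> steps, except for a bounded number
  of points near each end. The vertex \<open>x\<close> is sent to the uniform measure on all these points and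
  \<open>x\<close> itself. Moving the mass from one end of an edge to the other by shifting every point of the edge
  one step costs \<open>R \<ell> \<sqdot> \<ell> / (R \<ell>)\<^sup>2 = 1 / R\<close>, whatever the length of the edge, and the two gaps add only
  \<open>O(1 / R\<^sup>2)\<close> (\<open>edge_shift\<close>). Conversely a function on the vertices that is 1-Lipschitz along the edges,
  extended affinely over the segments and divided by \<open>R\<close>, is a Kantorovich potential for the cost
  \<open>dist\<^sup>2\<close> (\<open>interpolation_le_sqdist\<close>). On one segment this holds because distinct points are at
  least one step apart. Otherwise it holds because the affine extension is Lipschitz with a constant
  independent of \<open>R\<close> and the gaps keep points of different edges further apart than that constant
  times \<open>1 / R\<close>. Both facts come from one estimate (\<open>bary_diff_le\<close>): the barycentric coordinates of
  a point on a segment are Lipschitz functions of the point, since any four points of the moment curve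
  are affinely independent.

  For the constant of the Alexandrov spaces the same point configurations are used in a finite-dimensional
  space, the quotient of a Euclidean space \<open>(\<real>\<^sup>3)\<^sup>I\<close> by the permutations of \<open>I\<close>. It is complete and
  geodesic, and it inherits nonnegative curvature because all optimal permutations can be lifted
  relative to one given configuration, where the parallelogram law holds (\<open>match_dist_CBB0\<close>). It has at
  most continuum many points, so that a copy of it lives in any type that is at least as large as
  the reals. Both the shift along an edge, which is a permutation, and the potentials give the same
  bounds there (\<open>graph_snowflake\<close>).\<close>

section \<open>Segments between points of the moment curve\<close>

definition moment :: "nat \<Rightarrow> real^3" where
  "moment v = vector [real v, real v ^ 2, real v ^ 3]"

definition seg :: "nat \<Rightarrow> nat \<Rightarrow> real \<Rightarrow> real^3" where
  "seg a b t = (1 - t) *\<^sub>R moment a + t *\<^sub>R moment b"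

text \<open>The weight of the vertex \<open>v\<close> in the convex combination \<open>seg a b t\<close>. With \<open>a = b\<close> allowed, a vertex is
  also a degenerate segment and needs no separate treatment in the estimates.\<close>

definition bary :: "nat \<Rightarrow> nat \<Rightarrow> real \<Rightarrow> nat \<Rightarrow> real" where
  "bary a b t v = (if v = a then 1 - t else 0) + (if v = b then t else 0)"

lemma seg_swap: "seg a b t = seg b a (1 - t)"
  by (simp add: seg_def)

lemma bary_swap: "bary a b t = bary b a (1 - t)"
  by (auto simp: bary_def fun_eq_iff)

text \<open>A cubic polynomial is an affine functional on the moment curve. The one that vanishes at the other
  three of the four end points sees only the weight of \<open>a\<close>, and its value at \<open>a\<close> is at least 1 in
  modulus as the nodes are integers. Bounding its coefficients gives the Lipschitz constant.\<close>

lemma bary_first_diff_le: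
  fixes T :: nat
  assumes "a \<le> T" "b \<le> T" "a' \<le> T" "b' \<le> T"
  shows "\<bar>bary a b t a - bary a' b' t' a\<bar> \<le> 7 * real (T + 1)^2 * dist (seg a b t) (seg a' b' t')"
proof -
  define S where "S = real (T + 1)"
  \<comment> \<open>An end point that coincides with \<open>a\<close> is replaced by a node that carries no weight.\<close>
  define other where "other v = (if v = a then a + 1 else v)" for v
  define x y z where "x = real (other b)" and "y = real (other a')" and "z = real (other b')"
  have rng: "0 \<le> x" "x \<le> S" "0 \<le> y" "y \<le> S" "0 \<le> z" "z \<le> S" and S1: "1 \<le> S"
    using assms by (auto simp: x_def y_def z_def S_def other_def)
  define w where "w = seg a b t - seg a' b' t'"
  define q where "q s = (real s - x) * (real s - y) * (real s - z)" for s
  have qa: "\<bar>q a\<bar> \<ge> 1"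
  proof -
    have "\<bar>real a - real (other v)\<bar> \<ge> 1" for v
      by (auto simp: other_def)
    hence "1 * 1 * 1 \<le> \<bar>real a - x\<bar> * \<bar>real a - y\<bar> * \<bar>real a - z\<bar>"
      unfolding x_def y_def z_def by (intro mult_mono) auto
    thus ?thesis by (simp add: q_def abs_mult)
  qed
  have q0: "v = a \<or> q v = 0" if "v \<in> {b, a', b'}" for v
    using that by (auto simp: q_def x_def y_def z_def other_def)
  have comp: "w $ 1 = (1-t) * a + t * b - ((1-t') * a' + t' * b')"
    "w $ 2 = (1-t) * a^2 + t * b^2 - ((1-t') * a'^2 + t' * b'^2)"
    "w $ 3 = (1-t) * a^3 + t * b^3 - ((1-t') * a'^3 + t' * b'^3)"
    by (simp_all add: w_def seg_def moment_def)
  have "w $ 3 - (x + y + z) * w $ 2 + (x*y + y*z + z*x) * w $ 1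
      = (1-t) * q a + t * q b - ((1-t') * q a' + t' * q b')"
    unfolding comp q_def by (simp add: algebra_simps power2_eq_square power3_eq_cube)
  also have "\<dots> = (bary a b t a - bary a' b' t' a) * q a"
    using q0[of b] q0[of a'] q0[of b'] by (auto simp: bary_def algebra_simps)
  finally have eq: "(bary a b t a - bary a' b' t' a) * q a
      = w $ 3 - (x + y + z) * w $ 2 + (x*y + y*z + z*x) * w $ 1" by simp
  have "\<bar>bary a b t a - bary a' b' t' a\<bar> * 1 \<le> \<bar>bary a b t a - bary a' b' t' a\<bar> * \<bar>q a\<bar>"
    using qa by (intro mult_left_mono) auto
  also have "\<dots> = \<bar>w $ 3 - (x + y + z) * w $ 2 + (x*y + y*z + z*x) * w $ 1\<bar>"
    by (simp add: abs_mult[symmetric] eq)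
  also have "\<dots> \<le> \<bar>w $ 3\<bar> + (x + y + z) * \<bar>w $ 2\<bar> + (x*y + y*z + z*x) * \<bar>w $ 1\<bar>"
  proof -
    have "\<bar>(x + y + z) * w $ 2\<bar> = (x + y + z) * \<bar>w $ 2\<bar>"
      "\<bar>(x*y + y*z + z*x) * w $ 1\<bar> = (x*y + y*z + z*x) * \<bar>w $ 1\<bar>"
      using rng by (auto simp: abs_mult)
    thus ?thesis by linarith
  qed
  also have "\<dots> \<le> 1 * norm w + (S + S + S) * norm w + (S*S + S*S + S*S) * norm w"
    using rng S1 by (intro add_mono mult_mono component_le_norm_cart) (auto simp: component_le_norm_cart)
  also have "\<dots> \<le> 7 * S^2 * norm w"
  proof -
    have "1 \<le> S*S" "S \<le> S * S" using S1 mult_mono[of 1 S 1 S] mult_mono[of 1 S S S] by auto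
    hence "1 + (S + S + S) + (S*S + S*S + S*S) \<le> 7 * S^2"
      by (simp add: power2_eq_square)
    from mult_right_mono[OF this norm_ge_zero[of w]] show ?thesis by (simp add: algebra_simps)
  qed
  finally show ?thesis by (simp add: w_def dist_norm S_def)
qed

lemma bary_diff_le:
  fixes T :: nat
  assumes "a \<le> T" "b \<le> T" "a' \<le> T" "b' \<le> T"
  shows "\<bar>bary a b t v - bary a' b' t' v\<bar> \<le> 7 * real (T + 1)^2 * dist (seg a b t) (seg a' b' t')"
proof -
  consider "v = a" | "v = b" | "v = a'" | "v = b'" | "v \<notin> {a,b,a',b'}" by blast
  thus ?thesis
  proof cases
    case 1 thus ?thesis using bary_first_diff_le[OF assms] by simp
  next
    case 2 thus ?thesis
      using bary_first_diff_le[of b T a a' b' "1-t" t'] assms seg_swap[of a b t] bary_swap[of a b t] by simp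
  next
    case 3 thus ?thesis
      using bary_first_diff_le[of a' T b' a b t' t] assms by (simp add: dist_commute abs_minus_commute)
  next
    case 4 thus ?thesis
      using bary_first_diff_le[of b' T a' a b "1-t'" t] assms seg_swap[of a' b' t'] bary_swap[of a' b' t']
      by (simp add: dist_commute abs_minus_commute)
  next
    case 5 thus ?thesis by (simp add: bary_def)
  qed
qed

text \<open>Writing the interpolation as one sum over all vertices makes interpolations on different edges
  comparable: their difference is a combination of the differences of weights.\<close>

lemma interpolation_bary:
  assumes "a \<le> T" "b \<le> T"
  shows "(1 - t) * \<phi> a + t * \<phi> b = (\<Sum>v\<le>T. bary a b t v * \<phi> v)"
  using assms by (simp add: bary_def distrib_right sum.distrib if_distrib[of "\<lambda>x. x * _"] sum.delta cong: if_cong)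

lemma interpolation_lipschitz:
  fixes T :: nat and \<phi> :: "nat \<Rightarrow> real"
  assumes "a \<le> T" "b \<le> T" "a' \<le> T" "b' \<le> T" and "\<And>v. v \<le> T \<Longrightarrow> \<bar>\<phi> v\<bar> \<le> \<Phi>"
  shows "\<bar>((1 - t) * \<phi> a + t * \<phi> b) - ((1 - t') * \<phi> a' + t' * \<phi> b')\<bar>
       \<le> 7 * \<Phi> * real (T + 1)^3 * dist (seg a b t) (seg a' b' t')"
proof -
  let ?D = "7 * real (T + 1)^2 * dist (seg a b t) (seg a' b' t')"
  have "\<bar>((1 - t) * \<phi> a + t * \<phi> b) - ((1 - t') * \<phi> a' + t' * \<phi> b')\<bar>
      = \<bar>\<Sum>v\<le>T. (bary a b t v - bary a' b' t' v) * \<phi> v\<bar>"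
    unfolding left_diff_distrib sum_subtractf interpolation_bary[OF assms(1,2), symmetric]
      interpolation_bary[OF assms(3,4), symmetric] ..
  also have "\<dots> \<le> (\<Sum>v\<le>T. \<bar>bary a b t v - bary a' b' t' v\<bar> * \<bar>\<phi> v\<bar>)"
    by (metis (no_types, lifting) abs_mult sum.cong sum_abs)
  also have "\<dots> \<le> (\<Sum>v\<le>T. ?D * \<Phi>)"
    using assms by (intro sum_mono mult_mono bary_diff_le) auto
  also have "\<dots> = 7 * \<Phi> * real (T + 1)^3 * dist (seg a b t) (seg a' b' t')"
    by (simp add: power2_eq_square power3_eq_cube algebra_simps)
  finally show ?thesis .
qed

text \<open>Squared lengths are kept as natural numbers, which is possible as the vertices have integer
  coordinates. A segment can then be divided into exactly \<open>R * sqlen a b\<close> steps, which makes the cost of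
  a shift equal on all edges without rounding.\<close>

definition sqlen :: "nat \<Rightarrow> nat \<Rightarrow> nat" where
  "sqlen a b = nat ((int b - int a)^2 + (int b^2 - int a^2)^2 + (int b^3 - int a^3)^2)"

lemma sqlen_eq: "real (sqlen a b) = (dist (moment a) (moment b))^2"
proof -
  have "real (sqlen a b) = (real b - real a)^2 + (real b^2 - real a^2)^2 + (real b^3 - real a^3)^2"
    by (simp add: sqlen_def)
  also have "\<dots> = (dist (moment a) (moment b))^2"
    by (simp add: dist_norm power2_norm_eq_inner inner_vec_def sum_3 moment_def)
      (simp add: algebra_simps power2_eq_square)
  finally show ?thesis .
qed

lemma sqlen_pos: "a \<noteq> b \<Longrightarrow> sqlen a b > 0"
proof -
  assume "a \<noteq> b"
  hence "(int b - int a)^2 > 0" by simp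
  hence "(int b - int a)^2 + (int b^2 - int a^2)^2 + (int b^3 - int a^3)^2 > 0"
    by (intro add_pos_nonneg) auto
  thus ?thesis by (simp add: sqlen_def)
qed

lemma dist_seg: "(dist (seg a b s) (seg a b t))^2 = (s - t)^2 * real (sqlen a b)"
proof -
  have "seg a b s - seg a b t = (t - s) *\<^sub>R (moment a - moment b)"
    by (simp add: seg_def algebra_simps)
  hence "dist (seg a b s) (seg a b t) = \<bar>t - s\<bar> * dist (moment a) (moment b)"
    by (simp add: dist_norm)
  thus ?thesis by (simp add: sqlen_eq power_mult_distrib power2_commute)
qed

lemma seg_0 [simp]: "seg a b 0 = moment a" and seg_1 [simp]: "seg a b 1 = moment b"
  by (simp_all add: seg_def)

section \<open>Graphs as transport problems in three-space\<close>

text \<open>\<open>None\<close> stands for the vertex that distinguishes one configuration from another and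
  \<open>Some ((a, b), i)\<close> for the \<open>i\<close>th point of the edge \<open>(a, b)\<close>, which all configurations share.\<close>

type_synonym site = "((nat \<times> nat) \<times> nat) option"

text \<open>The first and last \<open>r\<close> points of each edge, where edges with a common vertex come close, are left
  out. An edge may occur in both directions; its points are then used twice, which is
  harmless as potentials depend on the place only.\<close>

definition sites :: "(nat \<times> nat) set \<Rightarrow> nat \<Rightarrow> nat \<Rightarrow> site set" where
  "sites E R r = insert None (Some ` (SIGMA e:E. {r..R * sqlen (fst e) (snd e) - r}))"

fun site_ends :: "nat \<Rightarrow> site \<Rightarrow> nat \<times> nat" where
  "site_ends x None = (x, x)"
| "site_ends x (Some (e, i)) = e"

fun site_param :: "nat \<Rightarrow> site \<Rightarrow> real" where
  "site_param R None = 0"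
| "site_param R (Some ((a, b), i)) = real i / real (R * sqlen a b)"

text \<open>For \<open>g = seg\<close> this is the place of a site in the configuration of the vertex \<open>x\<close>; for other \<open>g\<close> it is
  the value at the site of a function given edge by edge.\<close>

definition on_edge :: "(nat \<Rightarrow> nat \<Rightarrow> real \<Rightarrow> 'c) \<Rightarrow> nat \<Rightarrow> nat \<Rightarrow> site \<Rightarrow> 'c" where
  "on_edge g R x s = g (fst (site_ends x s)) (snd (site_ends x s)) (site_param R s)"

abbreviation position :: "nat \<Rightarrow> nat \<Rightarrow> site \<Rightarrow> real^3" where
  "position \<equiv> on_edge seg"

lemma on_edge_Some [simp]:
  "on_edge g R x (Some ((a, b), i)) = g a b (real i / real (R * sqlen a b))"
  by (simp add: on_edge_def)

lemma on_edge_None [simp]: "on_edge g R x None = g x x 0"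
  by (simp add: on_edge_def)

lemma finite_sites: "finite E \<Longrightarrow> finite (sites E R r)"
  by (simp add: sites_def)

text \<open>The cyclic permutation that moves the vertex \<open>a\<close> to the first point of the edge, each point to
  the next, and the last one to the vertex \<open>b\<close>. There are at most \<open>k = R * sqlen a b\<close> short steps of
  squared length \<open>sqlen a b / k\<^sup>2\<close>, and two steps that are \<open>r\<close> times as long.\<close>

lemma edge_shift:
  fixes R r :: nat
  assumes E: "finite E" "(a, b) \<in> E" "a \<noteq> b" and R: "R \<ge> 1" "2 * r \<le> R"
  obtains \<sigma> where "\<sigma> permutes sites E R r"
    "(\<Sum>s\<in>sites E R r. (dist (position R a s) (position R b (\<sigma> s)))^2) \<le> (1 + 2 * real r^2 / real R) / real R"
proof -
  define l where "l = sqlen a b"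
  define k where "k = R * l"
  have l: "l \<ge> 1" using sqlen_pos[OF E(3)] by (simp add: l_def)
  hence "R * 1 \<le> k" unfolding k_def by (intro mult_left_mono) auto
  hence k: "k \<ge> R" "k > 0" "2 * r \<le> k" using R by linarith+
  define I where "I = sites E R r"
  have finI: "finite I" using finite_sites[OF E(1)] by (simp add: I_def)
  define J where "J = insert None (Some ` ({(a, b)} \<times> {r..k - r}))"
  have J: "J \<subseteq> I" using E(2) by (auto simp: J_def I_def sites_def k_def l_def)
  define \<sigma> :: "site \<Rightarrow> site" where "\<sigma> s = (case s of None \<Rightarrow> Some ((a, b), r)
     | Some (e, i) \<Rightarrow> if e = (a, b) \<and> i \<in> {r..k - r}
          then (if i = k - r then None else Some (e, i + 1)) else s)" for s
  have \<sigma>_simps: "\<sigma> None = Some ((a, b), r)" "\<sigma> (Some ((a, b), k - r)) = None"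
    "i \<in> {r..<k - r} \<Longrightarrow> \<sigma> (Some ((a, b), i)) = Some ((a, b), i + 1)"
    "s \<notin> J \<Longrightarrow> \<sigma> s = s" for i s
    using k by (auto simp: \<sigma>_def J_def split: option.splits)
  have J_cases: "s = None \<or> s = Some ((a, b), k - r) \<or> (\<exists>i\<in>{r..<k - r}. s = Some ((a, b), i))"
    if "s \<in> J" for s
    using that k by (auto simp: J_def)
  have maps: "\<sigma> s \<in> J" if "s \<in> J" for s
    using J_cases[OF that] k by (auto simp: \<sigma>_simps) (auto simp: J_def)
  have inj: "inj_on \<sigma> J"
  proof (rule inj_onI)
    fix s s' assume "s \<in> J" "s' \<in> J" "\<sigma> s = \<sigma> s'"
    thus "s = s'"
      using J_cases[of s] J_cases[of s'] by (auto simp: \<sigma>_simps)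
  qed
  have "\<sigma> ` J = J"
    by (rule endo_inj_surj[OF finite_subset[OF J finI] _ inj]) (use maps in blast)
  with inj have "bij_betw \<sigma> J J" by (simp add: bij_betw_def)
  hence "\<sigma> permutes J" by (rule bij_imp_permutes) (rule \<sigma>_simps)
  hence perm: "\<sigma> permutes I" by (rule permutes_subset[OF _ J])
  let ?g = "\<lambda>s. (dist (position R a s) (position R b (\<sigma> s)))^2"
  have first: "?g None = (r / k)^2 * l"
    using dist_seg[of a b 0 "r / k"] by (simp add: \<sigma>_simps k_def l_def)
  have last: "?g (Some ((a, b), k - r)) = (r / k)^2 * l"
  proof -
    have "real (k - r) / real k - 1 = - (r / k)" using k by (simp add: of_nat_diff field_simps)
    thus ?thesis
      using dist_seg[of a b "real (k - r) / real k" 1]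
      by (simp add: \<sigma>_simps power_divide flip: k_def l_def)
  qed
  have inner: "?g (Some ((a, b), i)) = (1 / k)^2 * l" if "i \<in> {r..<k - r}" for i
  proof -
    have "real i / real k - real (i + 1) / real k = - (1 / k)"
      by (simp add: diff_divide_distrib[symmetric])
    thus ?thesis
      using dist_seg[of a b "real i / real k" "real (i + 1) / real k"] that
      by (simp add: \<sigma>_simps power_divide flip: k_def l_def)
  qed
  have "(\<Sum>s\<in>I. ?g s) = (\<Sum>s\<in>J. ?g s)"
  proof (rule sum.mono_neutral_right[OF finI J])
    show "\<forall>s\<in>I - J. ?g s = 0"
    proof
      fix s assume "s \<in> I - J"
      moreover from this obtain e i where "s = Some (e, i)"
        by (cases s) (auto simp: J_def)
      ultimately show "?g s = 0" by (cases e) (simp add: \<sigma>_simps)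
    qed
  qed
  also have "\<dots> = ?g None + (\<Sum>i\<in>{r..k - r}. ?g (Some ((a, b), i)))"
    unfolding J_def by (subst sum.insert) (auto simp: sum.reindex inj_on_def sum.cartesian_product')
  also have "(\<Sum>i\<in>{r..k - r}. ?g (Some ((a, b), i))) = (\<Sum>i\<in>{r..<k - r}. (1 / k)^2 * l) + (r / k)^2 * l"
  proof -
    have *: "{r..k - r} = insert (k - r) {r..<k - r}" using k by auto
    have "(\<Sum>i\<in>{r..<k - r}. ?g (Some ((a, b), i))) = (\<Sum>i\<in>{r..<k - r}. (1 / k)^2 * l)"
      by (intro sum.cong refl inner)
    moreover have "(\<Sum>i\<in>{r..k - r}. ?g (Some ((a, b), i)))
        = ?g (Some ((a, b), k - r)) + (\<Sum>i\<in>{r..<k - r}. ?g (Some ((a, b), i)))"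
      unfolding * by (rule sum.insert) auto
    ultimately show ?thesis unfolding last by linarith
  qed
  also have "?g None + ((\<Sum>i\<in>{r..<k - r}. (1 / k)^2 * l) + (r / k)^2 * l)
      = (real (k - r - r) + 2 * real r^2) * (l / k^2)"
    unfolding first by (simp add: power_divide algebra_simps add_divide_distrib)
  also have "\<dots> \<le> (k + 2 * real r^2) * (l / k^2)"
    by (intro mult_right_mono) auto
  also have "\<dots> = (1 + 2 * real r^2 / k) / R"
    using k R l by (simp add: k_def power2_eq_square field_simps)
  also have "\<dots> \<le> (1 + 2 * real r^2 / R) / R"
    using k R by (intro divide_right_mono add_left_mono divide_left_mono) auto
  finally show ?thesis using that[OF perm[unfolded I_def]] by (simp add: I_def)
qed

text \<open>A Lipschitz function with constant \<open>L\<close> satisfies \<open>L * d \<le> R * d\<^sup>2\<close> at distances \<open>d \<ge> L / R\<close>. That the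
  points are so far apart is read off from a weight in which they differ; the constant in the
  hypothesis is the product of the two Lipschitz constants.\<close>

lemma interpolation_le_sqdist_of_separated:
  fixes T :: nat and \<phi> :: "nat \<Rightarrow> real"
  assumes le: "a \<le> T" "b \<le> T" "a' \<le> T" "b' \<le> T" and \<phi>: "\<And>v. v \<le> T \<Longrightarrow> \<bar>\<phi> v\<bar> \<le> \<Phi>"
    and sep: "49 * \<Phi> * real (T + 1)^5 \<le> R * \<bar>bary a b t v - bary a' b' t' v\<bar>" and R: "R \<ge> 0"
  shows "((1 - t) * \<phi> a + t * \<phi> b) - ((1 - t') * \<phi> a' + t' * \<phi> b')
       \<le> R * (dist (seg a b t) (seg a' b' t'))^2"
proof -
  let ?d = "dist (seg a b t) (seg a' b' t')"
  have "7 * real (T + 1)^2 * (7 * \<Phi> * real (T + 1)^3) = 49 * \<Phi> * real (T + 1)^5"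
    by (simp add: power_add[of _ 2 3, simplified])
  also have "\<dots> \<le> R * (7 * real (T + 1)^2 * ?d)"
    using sep by (rule order_trans) (intro mult_left_mono bary_diff_le le R)
  finally have "7 * real (T + 1)^2 * (7 * \<Phi> * real (T + 1)^3) \<le> 7 * real (T + 1)^2 * (R * ?d)"
    by (simp add: mult_ac)
  hence "7 * \<Phi> * real (T + 1)^3 \<le> R * ?d"
    by (rule mult_left_le_imp_le) auto
  hence "7 * \<Phi> * real (T + 1)^3 * ?d \<le> R * ?d * ?d"
    by (rule mult_right_mono) auto
  moreover have "((1 - t) * \<phi> a + t * \<phi> b) - ((1 - t') * \<phi> a' + t' * \<phi> b') \<le> 7 * \<Phi> * real (T + 1)^3 * ?d"
    using interpolation_lipschitz[where \<phi> = \<phi> and \<Phi> = \<Phi> and t = t and t' = t', OF le \<phi>] by linarith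
  ultimately show ?thesis by (simp add: power2_eq_square mult_ac)
qed

text \<open>In units of one step the inequality becomes \<open>\<bar>i - i'\<bar> \<le> (i - i')\<^sup>2\<close>, which is true for integers. The
  numbering by integers lets the lemma also serve points that are numbered from the other end.\<close>

lemma interpolation_le_sqdist_same_edge:
  fixes \<phi> :: "nat \<Rightarrow> real"
  assumes "a \<noteq> b" "R \<ge> 1" and \<phi>: "\<bar>\<phi> a - \<phi> b\<bar> \<le> 1"
    and t: "t = real_of_int i / real (R * sqlen a b)" "t' = real_of_int i' / real (R * sqlen a b)"
  shows "((1 - t) * \<phi> a + t * \<phi> b) - ((1 - t') * \<phi> a + t' * \<phi> b)
       \<le> real R * (dist (seg a b t) (seg a b t'))^2"
proof -
  define k where "k = R * sqlen a b"
  have "sqlen a b > 0" "k > 0" using sqlen_pos[OF assms(1)] assms(2) by (auto simp: k_def)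
  have "((1 - t) * \<phi> a + t * \<phi> b) - ((1 - t') * \<phi> a + t' * \<phi> b) = (t - t') * (\<phi> b - \<phi> a)"
    by (simp add: algebra_simps)
  also have "\<dots> \<le> \<bar>t - t'\<bar> * 1"
    by (rule order_trans[OF abs_ge_self]) (use \<phi> in \<open>auto simp: abs_mult abs_minus_commute intro: mult_left_le\<close>)
  also have "\<dots> = real_of_int \<bar>i - i'\<bar> / k"
    by (simp add: t k_def diff_divide_distrib[symmetric] del: of_nat_mult)
  also have "\<dots> \<le> real_of_int (\<bar>i - i'\<bar>^2) / k"
  proof -
    have *: "n \<le> n^2" if "n \<ge> 0" for n :: int
      using self_le_power[of n 2] that by (cases "n = 0") auto
    have "\<bar>i - i'\<bar> \<le> \<bar>i - i'\<bar>^2" by (rule *) simp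
    thus ?thesis by (intro divide_right_mono, subst of_int_le_iff) auto
  qed
  also have "\<dots> = real R * ((t - t')^2 * sqlen a b)"
    using \<open>k > 0\<close> \<open>sqlen a b > 0\<close>
    by (simp add: t k_def diff_divide_distrib[symmetric] power_divide power2_eq_square)
  also have "\<dots> = real R * (dist (seg a b t) (seg a b t'))^2"
    by (simp add: dist_seg)
  finally show ?thesis .
qed

abbreviation interpolate :: "(nat \<Rightarrow> real) \<Rightarrow> nat \<Rightarrow> nat \<Rightarrow> real \<Rightarrow> real" where
  "interpolate \<phi> \<equiv> \<lambda>a b t. (1 - t) * \<phi> a + t * \<phi> b"

text \<open>Unless the two sites lie on the same edge or are the same vertex, some vertex has weight at least
  \<open>r / (R * \<Lambda>)\<close> in one of them and weight 0 in the other, so that they are separated enough. This is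
  where the choice of a large \<open>r\<close>, independent of \<open>R\<close>, enters.\<close>

lemma interpolation_le_sqdist:
  fixes T R r :: nat and \<phi> :: "nat \<Rightarrow> real"
  assumes E: "E \<subseteq> {..T} \<times> {..T}" "\<And>a b. (a, b) \<in> E \<Longrightarrow> a \<noteq> b"
    and \<Lambda>: "\<And>a b. (a, b) \<in> E \<Longrightarrow> sqlen a b \<le> \<Lambda>"
    and \<phi>: "\<And>v. v \<le> T \<Longrightarrow> \<bar>\<phi> v\<bar> \<le> \<Phi>" "\<And>a b. (a, b) \<in> E \<Longrightarrow> \<bar>\<phi> a - \<phi> b\<bar> \<le> 1"
    and r: "49 * \<Phi> * real (T + 1)^5 * real \<Lambda> \<le> real r"
    and R: "49 * \<Phi> * real (T + 1)^5 \<le> real R" "R \<ge> 1" "2 * r \<le> R"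
    and xy: "x \<le> T" "y \<le> T" and s: "s \<in> sites E R r" "s' \<in> sites E R r"
  shows "on_edge (interpolate \<phi>) R x s - on_edge (interpolate \<phi>) R y s'
       \<le> real R * (dist (position R x s) (position R y s'))^2"
proof -
  have \<phi>_sym: "\<bar>\<phi> a - \<phi> b\<bar> \<le> 1" if "(a, b) \<in> E \<or> (b, a) \<in> E" for a b
    using that \<phi>(2)[of a b] \<phi>(2)[of b a] by (auto simp: abs_minus_commute)
  have bounds: "a \<le> T \<and> b \<le> T" if "(a, b) \<in> E" for a b using E(1) that by auto
  have inner: "49 * \<Phi> * real (T + 1)^5 \<le> real R * \<bar>bary a b (real i / real (R * sqlen a b)) v\<bar>"
    if "(a, b) \<in> E" "i \<in> {r..R * sqlen a b - r}" "v \<in> {a, b}" for a b i v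
  proof -
    define k where "k = R * sqlen a b"
    have l: "sqlen a b > 0" using sqlen_pos[OF E(2)[OF that(1)]] .
    hence "R * 1 \<le> k" unfolding k_def by (intro mult_left_mono) auto
    hence k: "k > 0" "r \<le> k" using R by linarith+
    have "r + i \<le> k" using that(2) k by (auto simp: k_def[symmetric])
    hence "real (r + i) / real k \<le> 1" using k by (simp add: divide_le_eq)
    moreover have "real r / real k \<le> real i / real k"
      using that(2) by (intro divide_right_mono) auto
    ultimately have "real r / real k \<le> bary a b (real i / real k) v"
      using that(3) E(2)[OF that(1)] by (auto simp: bary_def add_divide_distrib)
    hence "real R * (real r / real k) \<le> real R * \<bar>bary a b (real i / real k) v\<bar>"
      by (intro mult_left_mono) auto
    moreover have "real R * (real r / real k) = real r / real (sqlen a b)"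
      using R by (simp add: k_def)
    moreover have "49 * \<Phi> * real (T + 1)^5 \<le> real r / real (sqlen a b)"
    proof -
      have "0 \<le> \<Phi>" using \<phi>(1)[of 0] by auto
      hence "49 * \<Phi> * real (T + 1)^5 * real (sqlen a b) \<le> 49 * \<Phi> * real (T + 1)^5 * real \<Lambda>"
        using \<Lambda>[OF that(1)] by (intro mult_left_mono) auto
      thus ?thesis using r l by (simp add: pos_le_divide_eq)
    qed
    ultimately show ?thesis by (simp add: k_def)
  qed
  note separated = interpolation_le_sqdist_of_separated[where \<phi> = \<phi> and \<Phi> = \<Phi> and T = T, OF _ _ _ _ \<phi>(1)]
  show ?thesis
  proof (cases s)
    case s_None: None
    show ?thesis
    proof (cases s')
      case None
      show ?thesis
      proof (cases "x = y")
        case False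
        thus ?thesis
          using separated[of x x y y "real R" 0 x 0] xy R s_None None by (simp add: bary_def)
      qed (use s_None None in simp)
    next
      case (Some ei)
      then obtain a b i where s': "s' = Some ((a, b), i)" by (metis prod.exhaust)
      with s(2) have ab: "(a, b) \<in> E" "i \<in> {r..R * sqlen a b - r}" by (auto simp: sites_def)
      obtain v where v: "v \<in> {a, b}" "v \<noteq> x" using E(2)[OF ab(1)] by auto
      have "bary x x 0 v = 0" using v(2) by (simp add: bary_def)
      thus ?thesis
        using separated[of x x a b "real R" 0 v "real i / real (R * sqlen a b)"]
          inner[OF ab v(1)] xy bounds[OF ab(1)] s_None s' by simp
    qed
  next
    case (Some ei)
    then obtain a b i where s_eq: "s = Some ((a, b), i)" by (metis prod.exhaust)
    with s(1) have ab: "(a, b) \<in> E" "i \<in> {r..R * sqlen a b - r}" by (auto simp: sites_def)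
    show ?thesis
    proof (cases s')
      case None
      obtain v where v: "v \<in> {a, b}" "v \<noteq> y" using E(2)[OF ab(1)] by auto
      have "bary y y 0 v = 0" using v(2) by (simp add: bary_def)
      thus ?thesis
        using separated[of a b y y "real R" "real i / real (R * sqlen a b)" v 0]
          inner[OF ab v(1)] xy bounds[OF ab(1)] s_eq None by simp
    next
      case (Some ei')
      then obtain a' b' i' where s': "s' = Some ((a', b'), i')" by (metis prod.exhaust)
      with s(2) have ab': "(a', b') \<in> E" "i' \<in> {r..R * sqlen a' b' - r}" by (auto simp: sites_def)
      consider "(a', b') = (a, b)" | "(a', b') = (b, a)" | v where "v \<in> {a, b}" "v \<notin> {a', b'}"
        using E(2)[OF ab(1)] E(2)[OF ab'(1)] by auto
      thus ?thesis
      proof cases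
        case 1
        thus ?thesis
          using interpolation_le_sqdist_same_edge[of a b R \<phi> _ "int i" _ "int i'"]
            E(2)[OF ab(1)] \<phi>_sym ab(1) R s_eq s' by simp
      next
        case 2
        define t t' where "t = real i / real (R * sqlen a b)" and "t' = real i' / real (R * sqlen a b)"
        have len: "sqlen b a = sqlen a b"
          by (metis dist_commute of_nat_eq_iff sqlen_eq)
        have "R * sqlen a b > 0" using sqlen_pos[OF E(2)[OF ab(1)]] R by simp
        hence t': "1 - t' = real_of_int (int (R * sqlen a b) - int i') / real (R * sqlen a b)"
          by (simp add: t'_def diff_divide_distrib)
        have "((1 - t) * \<phi> a + t * \<phi> b) - ((1 - (1 - t')) * \<phi> a + (1 - t') * \<phi> b)
            \<le> real R * (dist (seg a b t) (seg a b (1 - t')))^2"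
          using \<phi>_sym ab(1) by (intro interpolation_le_sqdist_same_edge[where i = "int i", OF E(2)[OF ab(1)] R(2) _ _ t'])
            (auto simp: t_def)
        moreover have "on_edge (interpolate \<phi>) R y s' = (1 - t') * \<phi> b + t' * \<phi> a"
          "position R y s' = seg a b (1 - t')"
          using 2 seg_swap[of b a t'] by (simp_all add: s' len t'_def)
        moreover have "on_edge (interpolate \<phi>) R x s = (1 - t) * \<phi> a + t * \<phi> b"
          "position R x s = seg a b t"
          by (simp_all add: s_eq t_def)
        ultimately show ?thesis by simp
      next
        case (3 v)
        have "bary a' b' (real i' / real (R * sqlen a' b')) v = 0" using 3(2) by (simp add: bary_def)
        thus ?thesis
          using separated[of a b a' b' "real R" "real i / real (R * sqlen a b)" v "real i' / real (R * sqlen a' b')"]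
            inner[OF ab 3(1)] bounds[OF ab(1)] bounds[OF ab'(1)] s_eq s' by simp
      qed
    qed
  qed
qed

text \<open>The square root of the path metric of a finite graph is realised up to a factor \<open>1 + \<delta>\<close> by optimal
  matchings of point configurations in three-space. The upper bound is stated through permutations
  and the lower bound through potentials for the cost \<open>dist\<^sup>2\<close>, as these control couplings of measures
  and matchings of points alike. The bound \<open>\<Phi>\<close> on the Lipschitz functions is given in advance because
  the width of the gaps depends on it; to recover the metric it is enough that \<open>\<Phi>\<close> exceeds its values.\<close>

lemma graph_snowflake:
  fixes E :: "(nat \<times> nat) set" and T :: nat and \<Phi> \<delta> :: real
  assumes E: "E \<subseteq> {..T} \<times> {..T}" "\<And>a b. (a, b) \<in> E \<Longrightarrow> a \<noteq> b" and "\<Phi> \<ge> 0" "\<delta> > 0"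
  obtains I :: "site set" and F :: "nat \<Rightarrow> site \<Rightarrow> real^3" and c :: real
  where "finite I" "I \<noteq> {}" "c > 0"
    and "\<And>a b. (a, b) \<in> E \<Longrightarrow>
      \<exists>\<sigma>. \<sigma> permutes I \<and> (\<Sum>i\<in>I. (dist (F a i) (F b (\<sigma> i)))^2) \<le> (1 + \<delta>) * c"
    and "\<And>\<phi>. \<forall>v\<le>T. \<bar>\<phi> v\<bar> \<le> \<Phi> \<Longrightarrow> \<forall>(a, b)\<in>E. \<bar>\<phi> a - \<phi> b\<bar> \<le> 1 \<Longrightarrow>
      \<exists>u. \<forall>x\<le>T. \<forall>y\<le>T. (\<forall>i\<in>I. \<forall>j\<in>I. u (F x i) - u (F y j) \<le> (dist (F x i) (F y j))^2) \<and>
        (\<Sum>i\<in>I. u (F x i)) - (\<Sum>i\<in>I. u (F y i)) = c * (\<phi> x - \<phi> y)"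
proof -
  have finE: "finite E" by (rule finite_subset[OF E(1)]) simp
  define \<Lambda> where "\<Lambda> = (\<Sum>e\<in>E. sqlen (fst e) (snd e))"
  have \<Lambda>: "sqlen a b \<le> \<Lambda>" if "(a, b) \<in> E" for a b
    unfolding \<Lambda>_def using member_le_sum[OF that, of "\<lambda>e. sqlen (fst e) (snd e)"] finE by simp
  define B where "B = 49 * \<Phi> * real (T + 1)^5"
  \<comment> \<open>The gaps are made wide enough for the potentials of the given size, and then the subdivision
    so fine that the cost \<open>2 * r\<^sup>2 / R\<^sup>2\<close> of crossing them is negligible against \<open>1 / R\<close>.\<close>
  obtain r :: nat where r: "B * real \<Lambda> \<le> real r" using real_arch_simple by blast
  obtain R :: nat where R': "max (max B 1) (max (2 * real r) (2 * real r^2 / \<delta>)) \<le> real R"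
    using real_arch_simple by blast
  hence R: "B \<le> real R" "R \<ge> 1" "2 * r \<le> R" "2 * real r^2 / \<delta> \<le> real R" by auto
  let ?I = "sites E R r" and ?c = "1 / real R"
  have cost: "(1 + 2 * real r^2 / real R) / real R \<le> (1 + \<delta>) * ?c"
    using R \<open>\<delta> > 0\<close> by (simp add: field_simps)
  show thesis
  proof (rule that[of ?I ?c "position R"])
    show "finite ?I" by (rule finite_sites[OF finE])
    show "?I \<noteq> {}" by (simp add: sites_def)
    show "?c > 0" using R by simp
  next
    fix a b assume ab: "(a, b) \<in> E"
    obtain \<sigma> where "\<sigma> permutes ?I"
      "(\<Sum>s\<in>?I. (dist (position R a s) (position R b (\<sigma> s)))^2) \<le> (1 + 2 * real r^2 / real R) / real R"
      by (rule edge_shift[OF finE ab E(2)[OF ab] R(2,3)])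
    with cost show "\<exists>\<sigma>. \<sigma> permutes ?I \<and>
        (\<Sum>s\<in>?I. (dist (position R a s) (position R b (\<sigma> s)))^2) \<le> (1 + \<delta>) * ?c"
      by (meson order_trans)
  next
    fix \<phi> :: "nat \<Rightarrow> real"
    assume "\<forall>v\<le>T. \<bar>\<phi> v\<bar> \<le> \<Phi>" "\<forall>(a, b)\<in>E. \<bar>\<phi> a - \<phi> b\<bar> \<le> 1"
    hence \<phi>: "\<And>v. v \<le> T \<Longrightarrow> \<bar>\<phi> v\<bar> \<le> \<Phi>" "\<And>a b. (a, b) \<in> E \<Longrightarrow> \<bar>\<phi> a - \<phi> b\<bar> \<le> 1"
      by auto
    let ?U = "on_edge (interpolate \<phi>) R"
    have le: "?U x s - ?U y s' \<le> real R * (dist (position R x s) (position R y s'))^2"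
      if "x \<le> T" "y \<le> T" "s \<in> ?I" "s' \<in> ?I" for x y s s'
      using interpolation_le_sqdist[OF E \<Lambda> \<phi> _ _ R(2,3) that] r R(1) by (simp add: B_def)
    \<comment> \<open>A potential has to be a function of the place and not of the site. Sites at the same place have
      the same interpolated value, by the inequality just shown in both directions.\<close>
    define rep where "rep z = (SOME (x, s). x \<le> T \<and> s \<in> ?I \<and> position R x s = z)" for z
    define u where "u z = (case rep z of (x, s) \<Rightarrow> ?U x s) / real R" for z
    have u: "u (position R x s) = ?U x s / real R" if "x \<le> T" "s \<in> ?I" for x s
    proof -
      have "case rep (position R x s) of (x', s') \<Rightarrow>
          x' \<le> T \<and> s' \<in> ?I \<and> position R x' s' = position R x s"
        unfolding rep_def by (rule someI[of _ "(x, s)"]) (use that in simp)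
      then obtain x' s' where xs': "rep (position R x s) = (x', s')" "x' \<le> T" "s' \<in> ?I"
        "position R x' s' = position R x s" by (auto split: prod.splits)
      have "?U x' s' = ?U x s"
        using le[OF that(1) xs'(2) that(2) xs'(3)] le[OF xs'(2) that(1) xs'(3) that(2)] xs'(4) by simp
      thus ?thesis by (simp add: u_def xs'(1))
    qed
    have "u (position R x s) - u (position R y s') \<le> (dist (position R x s) (position R y s'))^2"
      if "x \<le> T" "y \<le> T" "s \<in> ?I" "s' \<in> ?I" for x y s s'
      using le[OF that] R by (simp add: u that diff_divide_distrib[symmetric] pos_divide_le_eq mult.commute)
    moreover have "(\<Sum>s\<in>?I. u (position R x s)) - (\<Sum>s\<in>?I. u (position R y s)) = ?c * (\<phi> x - \<phi> y)"
      if "x \<le> T" "y \<le> T" for x y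
    proof -
      have "(\<Sum>s\<in>?I. u (position R x s)) - (\<Sum>s\<in>?I. u (position R y s))
          = (\<Sum>s\<in>?I. (?U x s - ?U y s) / real R)"
        by (simp add: sum_subtractf[symmetric] u that diff_divide_distrib)
      also have "\<dots> = (\<Sum>s\<in>{None}. (?U x s - ?U y s) / real R)"
      proof (rule sum.mono_neutral_right[OF finite_sites[OF finE]])
        show "\<forall>s\<in>?I - {None}. (?U x s - ?U y s) / real R = 0"
        proof
          fix s assume "s \<in> ?I - {None}"
          then obtain a b i where "s = Some ((a, b), i)" by (metis DiffE insertI1 not_Some_eq prod.exhaust)
          thus "(?U x s - ?U y s) / real R = 0" by simp
        qed
      qed (simp add: sites_def)
      also have "\<dots> = ?c * (\<phi> x - \<phi> y)" by simp
      finally show ?thesis .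
    qed
    ultimately show "\<exists>u. \<forall>x\<le>T. \<forall>y\<le>T. (\<forall>i\<in>?I. \<forall>j\<in>?I. u (position R x i) - u (position R y j)
          \<le> (dist (position R x i) (position R y j))^2) \<and>
        (\<Sum>i\<in>?I. u (position R x i)) - (\<Sum>i\<in>?I. u (position R y i)) = ?c * (\<phi> x - \<phi> y)"
      by (intro exI[of _ u]) blast
  qed
qed

section \<open>Transport between uniform measures on finitely many points\<close>

definition uniform_on :: "'i set \<Rightarrow> ('i \<Rightarrow> 'a::euclidean_space) \<Rightarrow> 'a measure" where
  "uniform_on I p = distr (measure_pmf (pmf_of_set I)) borel p"

context
  fixes I :: "'i set"
  assumes fin: "finite I" and ne: "I \<noteq> {}"
begin

lemma sets_uniform_on [simp]: "sets (uniform_on I p) = sets borel"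
  by (simp add: uniform_on_def)

lemma prob_space_uniform_on: "prob_space (uniform_on I p)"
  unfolding uniform_on_def by (rule measure_pmf.prob_space_distr) simp

lemma uniform_on_P2: "uniform_on I p \<in> P2"
proof -
  have "(\<integral>\<^sup>+x. ennreal ((norm x)^2) \<partial>uniform_on I p)
      = (\<Sum>i\<in>I. ennreal ((norm (p i))^2)) / of_nat (card I)"
    unfolding uniform_on_def using fin ne
    by (subst nn_integral_distr) (auto simp: nn_integral_pmf_of_set)
  also have "\<dots> < \<infinity>"
    using fin ne by (simp add: ennreal_divide_eq_top_iff less_top[symmetric])
  finally show ?thesis
    unfolding P2_def using prob_space_uniform_on by simp
qed

lemma permutation_coupling:
  fixes p q :: "'i \<Rightarrow> 'a::euclidean_space"
  assumes "\<sigma> permutes I"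
  shows "distr (measure_pmf (pmf_of_set I)) borel (\<lambda>i. (p i, q (\<sigma> i)))
       \<in> couplings (uniform_on I p) (uniform_on I q)"
proof -
  have "map_pmf \<sigma> (pmf_of_set I) = pmf_of_set I"
    using fin ne permutes_imp_bij[OF assms] by (simp add: map_pmf_of_set_bij_betw)
  hence "uniform_on I q = distr (distr (measure_pmf (pmf_of_set I)) (count_space UNIV) \<sigma>) borel q"
    by (simp add: uniform_on_def map_pmf_rep_eq[symmetric])
  also have "\<dots> = distr (measure_pmf (pmf_of_set I)) borel (\<lambda>i. q (\<sigma> i))"
    by (subst distr_distr) (simp_all add: o_def)
  finally have "distr (measure_pmf (pmf_of_set I)) borel (\<lambda>i. q (\<sigma> i)) = uniform_on I q" ..
  moreover have "distr (distr (measure_pmf (pmf_of_set I)) borel (\<lambda>i. (p i, q (\<sigma> i)))) borel fst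
      = uniform_on I p"
    by (subst distr_distr) (auto simp: uniform_on_def borel_prod[symmetric] space_pair_measure o_def)
  moreover have "distr (distr (measure_pmf (pmf_of_set I)) borel (\<lambda>i. (p i, q (\<sigma> i)))) borel snd
      = distr (measure_pmf (pmf_of_set I)) borel (\<lambda>i. q (\<sigma> i))"
    by (subst distr_distr) (auto simp: borel_prod[symmetric] space_pair_measure o_def)
  moreover have "prob_space (distr (measure_pmf (pmf_of_set I)) borel (\<lambda>i. (p i, q (\<sigma> i))))"
    by (rule measure_pmf.prob_space_distr) simp
  ultimately show ?thesis
    by (simp add: couplings_def)
qed

lemma transport_cost_le:
  fixes p q :: "'i \<Rightarrow> 'a::euclidean_space"
  assumes "\<sigma> permutes I"
  shows "(INF \<pi>\<in>couplings (uniform_on I p) (uniform_on I q).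
            \<integral>\<^sup>+z. ennreal ((dist (fst z) (snd z))^2) \<partial>\<pi>)
       \<le> ennreal ((\<Sum>i\<in>I. (dist (p i) (q (\<sigma> i)))^2) / real (card I))"
proof (rule INF_lower2[OF permutation_coupling[OF assms]])
  have "(\<integral>\<^sup>+z. ennreal ((dist (fst z) (snd z))^2)
            \<partial>distr (measure_pmf (pmf_of_set I)) borel (\<lambda>i. (p i, q (\<sigma> i))))
      = (\<Sum>i\<in>I. ennreal ((dist (p i) (q (\<sigma> i)))^2)) / of_nat (card I)"
    using fin ne by (subst nn_integral_distr) (auto simp: nn_integral_pmf_of_set borel_prod[symmetric] space_pair_measure)
  also have "\<dots> = ennreal ((\<Sum>i\<in>I. (dist (p i) (q (\<sigma> i)))^2) / real (card I))"
    using fin ne by (simp add: sum_ennreal divide_ennreal[symmetric] sum_nonneg card_gt_0_iff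
        ennreal_of_nat_eq_real_of_nat)
  finally show "(\<integral>\<^sup>+z. ennreal ((dist (fst z) (snd z))^2)
            \<partial>distr (measure_pmf (pmf_of_set I)) borel (\<lambda>i. (p i, q (\<sigma> i))))
      \<le> ennreal ((\<Sum>i\<in>I. (dist (p i) (q (\<sigma> i)))^2) / real (card I))" by simp
qed

lemma W2_uniform_on_le:
  fixes p q :: "'i \<Rightarrow> 'a::euclidean_space"
  assumes "\<sigma> permutes I"
  shows "(W2 (uniform_on I p) (uniform_on I q))^2 \<le> (\<Sum>i\<in>I. (dist (p i) (q (\<sigma> i)))^2) / real (card I)"
  using enn2real_mono[OF transport_cost_le[OF assms, of p q]]
  by (simp add: W2_def sum_nonneg)

text \<open>Weak Kantorovich duality: integrate the inequality between potential and cost against the coupling.\<close>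

lemma transport_cost_ge:
  fixes p q :: "'i \<Rightarrow> 'a::euclidean_space"
  assumes u: "\<And>i j. i \<in> I \<Longrightarrow> j \<in> I \<Longrightarrow> u (p i) - u (q j) \<le> (dist (p i) (q j))^2"
    and \<pi>: "\<pi> \<in> couplings (uniform_on I p) (uniform_on I q)"
  shows "ennreal (((\<Sum>i\<in>I. u (p i)) - (\<Sum>i\<in>I. u (q i))) / real (card I))
       \<le> (\<integral>\<^sup>+z. ennreal ((dist (fst z) (snd z))^2) \<partial>\<pi>)"
proof -
  have "prob_space \<pi>" and sets_\<pi>: "sets \<pi> = sets borel"
    and marg: "distr \<pi> borel fst = uniform_on I p" "distr \<pi> borel snd = uniform_on I q"
    using \<pi> unfolding couplings_def by blast+
  have [measurable_cong]: "sets \<pi> = sets (borel \<Otimes>\<^sub>M borel)"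
    unfolding sets_\<pi> borel_prod ..
  interpret prob_space \<pi> by fact
  define A where "A = p ` I \<union> q ` I"
  have finA: "finite A" using fin by (simp add: A_def)
  \<comment> \<open>The potential is arbitrary away from the finitely many points that carry the measures; cutting
    it off there makes it measurable and bounded.\<close>
  define v where "v z = (\<Sum>a\<in>A. u a * indicator {a} z)" for z
  have v_eq: "v z = u z" if "z \<in> A" for z
    using that finA by (simp add: v_def indicator_def if_distrib[of "\<lambda>x. _ * x"] sum.delta cong: if_cong)
  have v_meas [measurable]: "v \<in> borel_measurable borel"
    unfolding v_def by measurable
  have v_bdd: "\<bar>v z\<bar> \<le> (\<Sum>a\<in>A. \<bar>u a\<bar>)" for z
    unfolding v_def by (rule order_trans[OF sum_abs]) (auto intro!: sum_mono simp: indicator_def)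
  have int: "integrable \<pi> (\<lambda>z. v (fst z))" "integrable \<pi> (\<lambda>z. v (snd z))"
    by (auto intro!: integrable_const_bound[where B = "\<Sum>a\<in>A. \<bar>u a\<bar>"] simp: v_bdd)
  have lift: "(\<integral>z. v z \<partial>uniform_on I r) = (\<Sum>i\<in>I. u (r i)) / real (card I)"
    if "r ` I \<subseteq> A" for r :: "'i \<Rightarrow> 'a"
    using fin ne that v_eq
    by (auto simp: uniform_on_def integral_distr integral_pmf_of_set intro!: arg_cong[of _ _ "\<lambda>x. x / _"] sum.cong)
  have "(\<integral>z. v (fst z) - v (snd z) \<partial>\<pi>) = (\<integral>z. v z \<partial>distr \<pi> borel fst) - (\<integral>z. v z \<partial>distr \<pi> borel snd)"
    using int by (simp add: integral_distr)
  also have "\<dots> = ((\<Sum>i\<in>I. u (p i)) - (\<Sum>i\<in>I. u (q i))) / real (card I)"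
    by (simp add: marg lift A_def diff_divide_distrib)
  finally have eq: "(\<integral>z. v (fst z) - v (snd z) \<partial>\<pi>) = ((\<Sum>i\<in>I. u (p i)) - (\<Sum>i\<in>I. u (q i))) / real (card I)" .
  have closed: "{z\<in>space borel. z \<in> r ` I} \<in> sets borel" for r :: "'i \<Rightarrow> 'a"
    using fin by (simp add: finite_imp_closed borel_closed)
  have supp: "AE z in uniform_on I r. z \<in> r ` I" for r :: "'i \<Rightarrow> 'a"
    unfolding uniform_on_def using fin ne closed[of r]
    by (subst AE_distr_iff) (auto simp: AE_measure_pmf_iff)
  have "AE z in \<pi>. fst z \<in> p ` I" "AE z in \<pi>. snd z \<in> q ` I"
    using supp[of p] supp[of q] closed[of p] closed[of q]
    unfolding marg[symmetric] by (auto simp: AE_distr_iff)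
  hence "AE z in \<pi>. max 0 (v (fst z) - v (snd z)) \<le> (dist (fst z) (snd z))^2"
    by eventually_elim (use u v_eq in \<open>auto simp: A_def\<close>)
  hence le: "(\<integral>\<^sup>+z. ennreal (max 0 (v (fst z) - v (snd z))) \<partial>\<pi>)
      \<le> (\<integral>\<^sup>+z. ennreal ((dist (fst z) (snd z))^2) \<partial>\<pi>)"
    by (intro nn_integral_mono_AE) (auto elim!: eventually_mono intro: ennreal_leI)
  have intd: "integrable \<pi> (\<lambda>z. max 0 (v (fst z) - v (snd z)))"
    using int by auto
  have "ennreal (\<integral>z. v (fst z) - v (snd z) \<partial>\<pi>) \<le> ennreal (\<integral>z. max 0 (v (fst z) - v (snd z)) \<partial>\<pi>)"
    using int intd by (intro ennreal_leI integral_mono) auto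
  also have "\<dots> = (\<integral>\<^sup>+z. ennreal (max 0 (v (fst z) - v (snd z))) \<partial>\<pi>)"
    using intd by (intro nn_integral_eq_integral[symmetric]) auto
  finally show ?thesis using le by (simp add: eq)
qed

lemma W2_uniform_on_ge:
  fixes p q :: "'i \<Rightarrow> 'a::euclidean_space"
  assumes u: "\<And>i j. i \<in> I \<Longrightarrow> j \<in> I \<Longrightarrow> u (p i) - u (q j) \<le> (dist (p i) (q j))^2"
  shows "((\<Sum>i\<in>I. u (p i)) - (\<Sum>i\<in>I. u (q i))) / real (card I) \<le> (W2 (uniform_on I p) (uniform_on I q))^2"
    (is "?L \<le> _")
proof -
  let ?C = "INF \<pi>\<in>couplings (uniform_on I p) (uniform_on I q).
              \<integral>\<^sup>+z. ennreal ((dist (fst z) (snd z))^2) \<partial>\<pi>"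
  have "?C < \<infinity>"
    by (rule le_less_trans[OF transport_cost_le[OF permutes_id]]) simp
  moreover have "ennreal ?L \<le> ?C"
    by (rule INF_greatest) (rule transport_cost_ge[OF u])
  ultimately have "enn2real (ennreal ?L) \<le> enn2real ?C"
    by (intro enn2real_mono) auto
  moreover have "?L \<le> enn2real (ennreal ?L)"
    by (cases "?L \<ge> 0") (auto simp: ennreal_neg)
  ultimately show ?thesis by (simp add: W2_def)
qed

end

section \<open>Quotients of Euclidean spaces by permutations\<close>

text \<open>The distance of the orbits of \<open>p\<close> and \<open>q\<close> in the quotient of the Euclidean power by the permutations
  of \<open>I\<close>. On functions it is only a pseudometric.\<close>

definition match_dist :: "'i set \<Rightarrow> ('i \<Rightarrow> 'b::metric_space) \<Rightarrow> ('i \<Rightarrow> 'b) \<Rightarrow> real" where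
  "match_dist I p q = Min ((\<lambda>\<sigma>. L2_set (\<lambda>i. dist (p i) (q (\<sigma> i))) I) ` {\<sigma>. \<sigma> permutes I})"

lemma L2_set_permute: "\<sigma> permutes I \<Longrightarrow> L2_set (\<lambda>i. f (\<sigma> i)) I = L2_set f I"
  unfolding L2_set_def using sum.permute[of \<sigma> I "\<lambda>i. (f i)^2"] by (simp add: o_def)

lemma L2_dist_triangle:
  fixes p q r :: "'i \<Rightarrow> 'b::metric_space"
  shows "L2_set (\<lambda>i. dist (p i) (r i)) I \<le> L2_set (\<lambda>i. dist (p i) (q i)) I + L2_set (\<lambda>i. dist (q i) (r i)) I"
  by (rule order_trans[OF L2_set_mono L2_set_triangle_ineq]) (auto intro: dist_triangle)

context
  fixes I :: "'i set"
  assumes fin: "finite I"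
begin

lemma match_dist_attained:
  obtains \<sigma> where "\<sigma> permutes I" "match_dist I p q = L2_set (\<lambda>i. dist (p i) (q (\<sigma> i))) I"
proof -
  have "match_dist I p q \<in> (\<lambda>\<sigma>. L2_set (\<lambda>i. dist (p i) (q (\<sigma> i))) I) ` {\<sigma>. \<sigma> permutes I}"
    unfolding match_dist_def using finite_permutations[OF fin] permutes_id[of I]
    by (intro Min_in) blast+
  thus ?thesis using that by auto
qed

lemma match_dist_le:
  assumes "\<sigma> permutes I"
  shows "match_dist I p q \<le> L2_set (\<lambda>i. dist (p i) (q (\<sigma> i))) I"
  unfolding match_dist_def using finite_permutations[OF fin] assms by (intro Min_le) auto

lemma match_dist_le_L2: "match_dist I p q \<le> L2_set (\<lambda>i. dist (p i) (q i)) I"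
  using match_dist_le[OF permutes_id] by simp

lemma match_dist_permute_right [simp]:
  assumes "\<tau> permutes I"
  shows "match_dist I p (\<lambda>i. q (\<tau> i)) = match_dist I p q"
proof (rule antisym)
  have *: "match_dist I p q \<le> match_dist I p (\<lambda>i. q (\<tau> i))" if "\<tau> permutes I" for \<tau> q
  proof -
    obtain \<sigma> where "\<sigma> permutes I" "match_dist I p (\<lambda>i. q (\<tau> i)) = L2_set (\<lambda>i. dist (p i) (q (\<tau> (\<sigma> i)))) I"
      by (rule match_dist_attained)
    thus ?thesis using match_dist_le[OF permutes_compose[OF \<open>\<sigma> permutes I\<close> that], of p q] by simp
  qed
  show "match_dist I p q \<le> match_dist I p (\<lambda>i. q (\<tau> i))" by (rule *[OF assms])
  show "match_dist I p (\<lambda>i. q (\<tau> i)) \<le> match_dist I p q"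
    using *[OF permutes_inv[OF assms], of "\<lambda>i. q (\<tau> i)"] assms by (simp add: permutes_inverses)
qed

lemma match_dist_commute: "match_dist I p q = match_dist I q p"
proof (rule antisym)
  have *: "match_dist I q p \<le> match_dist I p q" for p q :: "'i \<Rightarrow> 'b::metric_space"
  proof -
    obtain \<sigma> where \<sigma>: "\<sigma> permutes I" "match_dist I p q = L2_set (\<lambda>i. dist (p i) (q (\<sigma> i))) I"
      by (rule match_dist_attained)
    have "match_dist I q p \<le> L2_set (\<lambda>i. dist (q i) (p (inv \<sigma> i))) I"
      by (rule match_dist_le[OF permutes_inv[OF \<sigma>(1)]])
    also have "\<dots> = L2_set (\<lambda>i. dist (q (\<sigma> i)) (p i)) I"
      using L2_set_permute[OF \<sigma>(1), of "\<lambda>i. dist (q i) (p (inv \<sigma> i))"] \<sigma>(1)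
      by (simp add: permutes_inverses)
    finally show ?thesis by (simp add: \<sigma>(2) dist_commute)
  qed
  show "match_dist I p q \<le> match_dist I q p" "match_dist I q p \<le> match_dist I p q" by (rule *)+
qed

lemma match_dist_permute_left [simp]:
  "\<tau> permutes I \<Longrightarrow> match_dist I (\<lambda>i. p (\<tau> i)) q = match_dist I p q"
  by (metis match_dist_commute match_dist_permute_right)

lemma match_dist_triangle: "match_dist I p r \<le> match_dist I p q + match_dist I q r"
proof -
  obtain \<sigma> where \<sigma>: "\<sigma> permutes I" "match_dist I p q = L2_set (\<lambda>i. dist (p i) (q (\<sigma> i))) I"
    by (rule match_dist_attained)
  obtain \<tau> where \<tau>: "\<tau> permutes I" "match_dist I (\<lambda>i. q (\<sigma> i)) r = L2_set (\<lambda>i. dist (q (\<sigma> i)) (r (\<tau> i))) I"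
    by (rule match_dist_attained)
  have "match_dist I p r \<le> L2_set (\<lambda>i. dist (p i) (r (\<tau> i))) I"
    by (rule match_dist_le[OF \<tau>(1)])
  also have "\<dots> \<le> L2_set (\<lambda>i. dist (p i) (q (\<sigma> i))) I + L2_set (\<lambda>i. dist (q (\<sigma> i)) (r (\<tau> i))) I"
    by (rule L2_dist_triangle)
  finally show ?thesis using \<sigma> \<tau> by simp
qed

lemma match_dist_nonneg [simp]: "match_dist I p q \<ge> 0"
  by (metis L2_set_nonneg match_dist_attained)

lemma match_dist_self [simp]: "match_dist I p p = 0"
  using match_dist_le_L2[of p p] by (simp add: L2_set_0' antisym)

text \<open>The straight line from \<open>p\<close> to an optimally permuted \<open>q\<close> is a geodesic of the quotient: no distance on
  it can be shorter than on the line, as the distances of three consecutive pieces add up to at least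
  that of the end points.\<close>

lemma match_dist_geodesic:
  fixes p q :: "'i \<Rightarrow> 'b::real_normed_vector"
  obtains \<gamma> where "match_dist I (\<gamma> 0) p = 0" "match_dist I (\<gamma> 1) q = 0"
    "\<And>s t. s \<in> {0..1} \<Longrightarrow> t \<in> {0..1} \<Longrightarrow> match_dist I (\<gamma> s) (\<gamma> t) = \<bar>s - t\<bar> * match_dist I p q"
proof -
  obtain \<sigma> where \<sigma>: "\<sigma> permutes I" "match_dist I p q = L2_set (\<lambda>i. dist (p i) (q (\<sigma> i))) I"
    by (rule match_dist_attained)
  define \<gamma> where "\<gamma> t = (\<lambda>i. (1 - t) *\<^sub>R p i + t *\<^sub>R q (\<sigma> i))" for t :: real
  have ends: "match_dist I (\<gamma> 0) p = 0" "match_dist I (\<gamma> 1) q = 0"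
    using \<sigma>(1) by (simp_all add: \<gamma>_def)
  have le: "match_dist I (\<gamma> s) (\<gamma> t) \<le> \<bar>s - t\<bar> * match_dist I p q" for s t
  proof -
    have "\<gamma> s i - \<gamma> t i = (t - s) *\<^sub>R (p i - q (\<sigma> i))" for i
      by (simp add: \<gamma>_def algebra_simps)
    hence "dist (\<gamma> s i) (\<gamma> t i) = \<bar>s - t\<bar> * dist (p i) (q (\<sigma> i))" for i
      by (simp add: dist_norm abs_minus_commute)
    thus ?thesis
      using match_dist_le_L2[of "\<gamma> s" "\<gamma> t"] by (simp add: \<sigma>(2) L2_set_right_distrib)
  qed
  have eq: "match_dist I (\<gamma> s) (\<gamma> t) = \<bar>s - t\<bar> * match_dist I p q" if "0 \<le> s" "s \<le> t" "t \<le> 1" for s t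
  proof -
    have "match_dist I p q \<le> match_dist I p (\<gamma> 0) + match_dist I (\<gamma> 0) (\<gamma> s) + match_dist I (\<gamma> s) (\<gamma> t)
        + match_dist I (\<gamma> t) (\<gamma> 1) + match_dist I (\<gamma> 1) q"
      using match_dist_triangle[of p q "\<gamma> 0"] match_dist_triangle[of "\<gamma> 0" q "\<gamma> s"]
        match_dist_triangle[of "\<gamma> s" q "\<gamma> t"] match_dist_triangle[of "\<gamma> t" q "\<gamma> 1"] by linarith
    also have "\<dots> \<le> s * match_dist I p q + match_dist I (\<gamma> s) (\<gamma> t) + (1 - t) * match_dist I p q"
      using le[of 0 s] le[of t 1] that ends by (simp add: match_dist_commute[of p])
    finally have "(t - s) * match_dist I p q \<le> match_dist I (\<gamma> s) (\<gamma> t)"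
      by (simp add: algebra_simps)
    thus ?thesis using le[of s t] that by auto
  qed
  have "match_dist I (\<gamma> s) (\<gamma> t) = \<bar>s - t\<bar> * match_dist I p q" if "s \<in> {0..1}" "t \<in> {0..1}" for s t
    using eq[of s t] eq[of t s] that
    by (cases "s \<le> t") (auto simp: match_dist_commute[of "\<gamma> s"] abs_minus_commute)
  with ends show ?thesis using that by blast
qed

text \<open>The members of a Cauchy sequence can be permuted so as to stay at a bounded distance from one of
  them. Then each coordinate is bounded, and a coordinatewise convergent subsequence gives the limit.\<close>

lemma match_dist_complete:
  fixes x :: "nat \<Rightarrow> 'i \<Rightarrow> 'b::heine_borel"
  assumes Cauchy: "\<And>\<epsilon>. \<epsilon> > 0 \<Longrightarrow> \<exists>N. \<forall>m\<ge>N. \<forall>n\<ge>N. match_dist I (x m) (x n) < \<epsilon>"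
  obtains l where "(\<lambda>n. match_dist I (x n) l) \<longlonglongrightarrow> 0"
proof -
  obtain N where N: "\<And>m n. m \<ge> N \<Longrightarrow> n \<ge> N \<Longrightarrow> match_dist I (x m) (x n) < 1"
    using Cauchy[of 1] by auto
  have "\<exists>\<sigma>. \<sigma> permutes I \<and> match_dist I (x N) (x n) = L2_set (\<lambda>i. dist (x N i) (x n (\<sigma> i))) I" for n
    using match_dist_attained by blast
  then obtain \<sigma> where \<sigma>: "\<And>n. \<sigma> n permutes I"
    "\<And>n. match_dist I (x N) (x n) = L2_set (\<lambda>i. dist (x N i) (x n (\<sigma> n i))) I"
    by metis
  define y where "y n = (\<lambda>i. x (n + N) (\<sigma> (n + N) i))" for n
  have "bounded ((\<lambda>f. f i) ` range y)" if "i \<in> I" for i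
    unfolding bounded_def
  proof (intro exI ballI)
    fix z assume "z \<in> (\<lambda>f. f i) ` range y"
    then obtain n where z: "z = x (n + N) (\<sigma> (n + N) i)" by (auto simp: y_def)
    have "dist (x N i) z \<le> L2_set (\<lambda>i. dist (x N i) (x (n + N) (\<sigma> (n + N) i))) I"
      unfolding z using member_le_L2_set[OF fin that, of "\<lambda>i. dist (x N i) (x (n + N) (\<sigma> (n + N) i))"] .
    also have "\<dots> \<le> 1" using N[of N "n + N"] by (simp add: \<sigma>(2)[symmetric])
    finally show "dist (x N i) z \<le> 1" .
  qed
  from compact_lemma_general[where proj = "\<lambda>f i. f i" and unproj = "\<lambda>f. f", OF fin this]
  obtain l r where r: "strict_mono r"
    and lim: "\<And>\<epsilon>. \<epsilon> > 0 \<Longrightarrow> eventually (\<lambda>n. \<forall>i\<in>I. dist (y (r n) i) (l i) < \<epsilon>) sequentially"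
    by blast
  have "(\<lambda>n. match_dist I (x n) l) \<longlonglongrightarrow> 0"
  proof (rule metric_LIMSEQ_I)
    fix \<epsilon> :: real assume \<epsilon>: "\<epsilon> > 0"
    obtain M where M: "\<And>m n. m \<ge> M \<Longrightarrow> n \<ge> M \<Longrightarrow> match_dist I (x m) (x n) < \<epsilon> / 2"
      using Cauchy[of "\<epsilon> / 2"] \<epsilon> by auto
    define \<delta> where "\<delta> = \<epsilon> / (2 * (real (card I) + 1))"
    have "\<delta> > 0" using \<epsilon> by (simp add: \<delta>_def)
    then obtain k0 where k0: "\<And>n. n \<ge> k0 \<Longrightarrow> \<forall>i\<in>I. dist (y (r n) i) (l i) < \<delta>"
      using lim by (auto simp: eventually_sequentially)
    define k where "k = max k0 M"
    have "r k + N \<ge> M" using seq_suble[OF r, of k] by (simp add: k_def)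
    have "match_dist I (x (r k + N)) l = match_dist I (y (r k)) l"
      by (simp add: y_def \<sigma>(1))
    also have "\<dots> \<le> (\<Sum>i\<in>I. dist (y (r k) i) (l i))"
      by (rule order_trans[OF match_dist_le_L2 L2_set_le_sum]) auto
    also have "\<dots> \<le> (\<Sum>i\<in>I. \<delta>)"
      using k0[of k] by (intro sum_mono) (auto simp: k_def less_imp_le)
    also have "\<dots> < \<epsilon> / 2"
      using \<epsilon> by (simp add: \<delta>_def field_simps)
    finally have "match_dist I (x (r k + N)) l < \<epsilon> / 2" .
    hence "dist (match_dist I (x n) l) 0 < \<epsilon>" if "n \<ge> M" for n
      using M[OF that \<open>r k + N \<ge> M\<close>] match_dist_triangle[of "x n" l "x (r k + N)"] by simp
    thus "\<exists>no. \<forall>n\<ge>no. dist (match_dist I (x n) l) 0 < \<epsilon>" by blast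
  qed
  thus ?thesis using that by blast
qed

text \<open>The configurations \<open>x\<close>, \<open>y\<close>, \<open>z\<close> are permuted to \<open>a\<close>, \<open>b\<close>, \<open>c\<close> so as to match \<open>w\<close> optimally. Then
  \<open>w\<close> is the midpoint of \<open>a\<close> and \<open>b\<close> in the Euclidean sense, because these are at least as far apart as
  \<open>x\<close> and \<open>y\<close> in the quotient. The inequality follows from the parallelogram law: the distance of \<open>c\<close>
  and \<open>w\<close> equals that of \<open>z\<close> and \<open>w\<close>, whereas those of \<open>c\<close> from \<open>a\<close> and \<open>b\<close> can only drop in the
  quotient.\<close>

lemma match_dist_CBB0:
  fixes x y z w :: "'i \<Rightarrow> 'b::real_inner"
  assumes mid: "match_dist I w x = 1/2 * match_dist I x y" "match_dist I w y = 1/2 * match_dist I x y"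
  shows "(match_dist I z w)^2 + 1/4 * (match_dist I x y)^2
       \<ge> 1/2 * (match_dist I z x)^2 + 1/2 * (match_dist I z y)^2"
proof -
  define D where "D = match_dist I x y"
  obtain \<alpha> where \<alpha>: "\<alpha> permutes I" "match_dist I w x = L2_set (\<lambda>i. dist (w i) (x (\<alpha> i))) I"
    by (rule match_dist_attained)
  obtain \<beta> where \<beta>: "\<beta> permutes I" "match_dist I w y = L2_set (\<lambda>i. dist (w i) (y (\<beta> i))) I"
    by (rule match_dist_attained)
  obtain \<gamma> where \<gamma>: "\<gamma> permutes I" "match_dist I w z = L2_set (\<lambda>i. dist (w i) (z (\<gamma> i))) I"
    by (rule match_dist_attained)
  define a b c where "a i = x (\<alpha> i)" and "b i = y (\<beta> i)" and "c i = z (\<gamma> i)" for i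
  have sq: "(L2_set (\<lambda>i. dist (f i) (g i)) I)^2 = (\<Sum>i\<in>I. (norm (f i - g i))^2)"
    for f g :: "'i \<Rightarrow> 'b"
    by (simp add: L2_set_def sum_nonneg dist_norm)
  have wa: "(\<Sum>i\<in>I. (norm (w i - a i))^2) = 1/4 * D^2"
    and wb: "(\<Sum>i\<in>I. (norm (w i - b i))^2) = 1/4 * D^2"
    unfolding sq[symmetric] a_def b_def
    by (simp_all add: \<alpha>(2)[symmetric] \<beta>(2)[symmetric] mid D_def power_divide)
  have wc: "(\<Sum>i\<in>I. (norm (w i - c i))^2) = (match_dist I z w)^2"
    unfolding sq[symmetric] c_def by (simp add: \<gamma>(2)[symmetric] match_dist_commute[of z])
  have le: "(match_dist I p q)^2 \<le> (\<Sum>i\<in>I. (norm (p i - q i))^2)" for p q :: "'i \<Rightarrow> 'b"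
    unfolding sq[symmetric] by (rule power_mono[OF match_dist_le_L2]) simp
  have ab: "D^2 \<le> (\<Sum>i\<in>I. (norm (a i - b i))^2)"
    using le[of a b] \<alpha>(1) \<beta>(1) unfolding a_def b_def D_def by simp
  have ca: "(match_dist I z x)^2 \<le> (\<Sum>i\<in>I. (norm (c i - a i))^2)"
    using le[of c a] \<alpha>(1) \<gamma>(1) unfolding a_def c_def by simp
  have cb: "(match_dist I z y)^2 \<le> (\<Sum>i\<in>I. (norm (c i - b i))^2)"
    using le[of c b] \<beta>(1) \<gamma>(1) unfolding b_def c_def by simp
  have mid_eq: "a i + b i = 2 *\<^sub>R w i" if "i \<in> I" for i
  proof -
    have "(norm (a i + b i - 2 *\<^sub>R w i))^2 = 2 * (norm (w i - a i))^2 + 2 * (norm (w i - b i))^2 - (norm (a i - b i))^2" for i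
      by (simp add: power2_norm_eq_inner inner_simps inner_commute)
    hence "(\<Sum>i\<in>I. (norm (a i + b i - 2 *\<^sub>R w i))^2) = 2 * (1/4 * D^2) + 2 * (1/4 * D^2) - (\<Sum>i\<in>I. (norm (a i - b i))^2)"
      by (simp add: sum.distrib sum_subtractf sum_distrib_left[symmetric] wa wb)
    also have "\<dots> \<le> 0" using ab by simp
    finally have "(\<Sum>i\<in>I. (norm (a i + b i - 2 *\<^sub>R w i))^2) \<le> 0" .
    moreover have "(\<Sum>i\<in>I. (norm (a i + b i - 2 *\<^sub>R w i))^2) \<ge> 0"
      by (intro sum_nonneg) simp
    ultimately have "(\<Sum>i\<in>I. (norm (a i + b i - 2 *\<^sub>R w i))^2) = 0"
      by linarith
    thus ?thesis using that fin by (simp add: sum_nonneg_eq_0_iff)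
  qed
  have "(norm (c i - a i))^2 + (norm (c i - b i))^2 = 2 * (norm (w i - c i))^2 + (norm (w i - a i))^2 + (norm (w i - b i))^2"
    if "i \<in> I" for i
  proof -
    have b: "b i = 2 *\<^sub>R w i - a i" using mid_eq[OF that] by (simp add: algebra_simps)
    show ?thesis unfolding b
      by (simp add: power2_norm_eq_inner inner_simps inner_commute algebra_simps)
  qed
  hence "(\<Sum>i\<in>I. (norm (c i - a i))^2 + (norm (c i - b i))^2)
       = (\<Sum>i\<in>I. 2 * (norm (w i - c i))^2 + (norm (w i - a i))^2 + (norm (w i - b i))^2)"
    by (intro sum.cong) auto
  hence "(\<Sum>i\<in>I. (norm (c i - a i))^2) + (\<Sum>i\<in>I. (norm (c i - b i))^2) = 2 * (match_dist I z w)^2 + 1/2 * D^2"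
    by (simp add: sum.distrib sum_distrib_left[symmetric] wa wb wc)
  thus ?thesis using ca cb by (simp add: D_def)
qed

end

text \<open>The points at distance 0 are identified by choosing representatives, which keeps the quotient in a
  type that contains the original points.\<close>

lemma pseudometric_quotient:
  fixes D :: "'b \<Rightarrow> 'b \<Rightarrow> real"
  assumes h: "inj (h :: 'b \<Rightarrow> 'a)"
    and D: "\<And>p q. D p q \<ge> 0" "\<And>p. D p p = 0" "\<And>p q. D p q = D q p" "\<And>p q r. D p r \<le> D p q + D q r"
  obtains g :: "'b \<Rightarrow> 'a" and d where "Metric_space (range g) d" "\<And>p q. d (g p) (g q) = D p q"
proof -
  define rep where "rep p = (SOME q. D p q = 0)" for p
  have rep: "D p (rep p) = 0" for p
    unfolding rep_def by (rule someI[of _ p]) (rule D)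
  have rep_eq: "rep p = rep q" if "D p q = 0" for p q
  proof -
    have "D p r = 0 \<longleftrightarrow> D q r = 0" for r
      using D(1)[of p r] D(1)[of q r] D(4)[of p r q] D(4)[of q r p] D(3)[of p q] that by auto
    thus ?thesis by (simp add: rep_def)
  qed
  have D_rep: "D (rep p) (rep q) = D p q" for p q
    using D(4)[of "rep p" "rep q" p] D(4)[of p "rep q" q] D(4)[of p q "rep p"] D(4)[of "rep p" q "rep q"]
      rep[of p] rep[of q] D(3)[of p "rep p"] D(3)[of q "rep q"] by linarith
  define g where "g p = h (rep p)" for p
  define d where "d x y = D (inv h x) (inv h y)" for x y
  have dg: "d (g p) (g q) = D p q" for p q
    using h by (simp add: d_def g_def D_rep)
  have "Metric_space (range g) d"
  proof
    show "0 \<le> d x y" "d x y = d y x" for x y by (auto simp: d_def D)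
    show "d x y = 0 \<longleftrightarrow> x = y" if "x \<in> range g" "y \<in> range g" for x y
      using that D(2) rep_eq by (auto simp: dg) (simp add: g_def)
    show "d x z \<le> d x y + d y z" for x y z by (simp add: d_def D)
  qed
  with dg show ?thesis using that by blast
qed

text \<open>A real number can be coded by a set of naturals, and countably many sets of naturals by one.\<close>

lemma configurations_lepoll_reals:
  "(UNIV :: ('i::countable \<Rightarrow> real^('k::finite)) set) \<lesssim> (UNIV :: real set)"
proof -
  obtain e :: "real \<Rightarrow> nat set" where e: "inj e"
    using eqpoll_imp_lepoll[OF eqpoll_sym[OF nat_sets_eqpoll_reals]] by (auto simp: lepoll_def)
  obtain tn :: "'k \<Rightarrow> nat" where tn: "inj tn"
    using finite_imp_inj_to_nat_seg[of "UNIV :: 'k set"] by auto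
  define c :: "('i \<Rightarrow> real^'k) \<Rightarrow> nat set"
    where "c f = {to_nat (i, tn j, k) | i j k. k \<in> e (f i $ j)}" for f
  have "f = f'" if "c f = c f'" for f f'
  proof -
    have mem: "k \<in> e (f i $ j) \<longleftrightarrow> to_nat (i, tn j, k) \<in> c f" for f i j k
      using tn by (auto simp: c_def inj_eq)
    have "e (f i $ j) = e (f' i $ j)" for i j
      using mem[of _ f i j] mem[of _ f' i j] that by auto
    thus ?thesis using e by (simp add: inj_eq fun_eq_iff vec_eq_iff)
  qed
  hence "inj c" by (simp add: inj_def)
  hence "(UNIV :: ('i \<Rightarrow> real^'k) set) \<lesssim> (UNIV :: nat set set)"
    by (auto simp: lepoll_def)
  thus ?thesis
    using lepoll_trans[OF _ eqpoll_imp_lepoll[OF nat_sets_eqpoll_reals]] by blast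
qed

lemma match_dist_realisation:
  fixes I :: "'i::countable set"
  assumes I: "finite I" and card: "(UNIV :: real set) \<lesssim> (UNIV :: 'a set)"
  obtains g :: "('i \<Rightarrow> real^('k::finite)) \<Rightarrow> 'a" and d
  where "complete_CBB0 (range g) d" "\<And>p q. d (g p) (g q) = match_dist I p q"
proof -
  obtain h :: "('i \<Rightarrow> real^'k) \<Rightarrow> 'a" where h: "inj h"
    using lepoll_trans[OF configurations_lepoll_reals card] by (auto simp: lepoll_def)
  obtain g :: "('i \<Rightarrow> real^'k) \<Rightarrow> 'a" and d
    where met: "Metric_space (range g) d" and d: "\<And>p q. d (g p) (g q) = match_dist I p q"
    by (rule pseudometric_quotient[OF h, of "match_dist I"])
      (auto simp: I match_dist_triangle match_dist_commute)
  interpret Metric_space "range g" d by fact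
  have "\<exists>\<gamma>\<in>{0..1::real} \<rightarrow> range g. \<gamma> 0 = g p \<and> \<gamma> 1 = g q \<and>
        (\<forall>s\<in>{0..1}. \<forall>t\<in>{0..1}. d (\<gamma> s) (\<gamma> t) = \<bar>s - t\<bar> * d (g p) (g q))" for p q
  proof -
    obtain \<gamma> where \<gamma>: "match_dist I (\<gamma> 0) p = 0" "match_dist I (\<gamma> 1) q = 0"
      "\<And>s t. s \<in> {0..1} \<Longrightarrow> t \<in> {0..1} \<Longrightarrow> match_dist I (\<gamma> s) (\<gamma> t) = \<bar>s - t\<bar> * match_dist I p q"
      by (rule match_dist_geodesic[OF I]) blast
    have "g a = g b" if "match_dist I a b = 0" for a b
      using zero[of "g a" "g b"] that by (simp add: d)
    hence "g (\<gamma> 0) = g p" "g (\<gamma> 1) = g q"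
      using \<gamma>(1,2) by blast+
    thus ?thesis using \<gamma>(3) by (intro bexI[of _ "\<lambda>t. g (\<gamma> t)"]) (auto simp: d)
  qed
  hence "geodesic_space (range g) d"
    using met by (auto simp: geodesic_space_def)
  moreover have "mcomplete"
    unfolding mcomplete_def
  proof (intro allI impI)
    fix s assume s: "MCauchy s"
    hence "\<forall>n. \<exists>y. s n = g y" unfolding MCauchy_def by blast
    then obtain x where x: "\<And>n. s n = g (x n)" by metis
    have "\<exists>N. \<forall>m\<ge>N. \<forall>n\<ge>N. match_dist I (x m) (x n) < \<epsilon>" if "\<epsilon> > 0" for \<epsilon>
      using s that by (auto simp: MCauchy_def x d)
    from match_dist_complete[OF I this]
    obtain l where "(\<lambda>n. match_dist I (x n) l) \<longlonglongrightarrow> 0" by blast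
    hence "limitin mtopology s (g l) sequentially"
      by (auto simp: limit_metric_sequentially x d LIMSEQ_def I)
    thus "\<exists>l. limitin mtopology s l sequentially" by blast
  qed
  ultimately have "complete_CBB0 (range g) d"
    unfolding complete_CBB0_def using match_dist_CBB0[OF I] by (auto simp: d)
  with d show ?thesis using that by blast
qed

lemma match_dist_sq_le:
  "finite I \<Longrightarrow> \<sigma> permutes I \<Longrightarrow> (match_dist I p q)^2 \<le> (\<Sum>i\<in>I. (dist (p i) (q (\<sigma> i)))^2)"
  using power_mono[OF match_dist_le, of I \<sigma> p q 2] by (simp add: L2_set_def sum_nonneg)

lemma match_dist_sq_ge:
  fixes u :: "'b::metric_space \<Rightarrow> real"
  assumes "finite I" and u: "\<And>i j. i \<in> I \<Longrightarrow> j \<in> I \<Longrightarrow> u (p i) - u (q j) \<le> (dist (p i) (q j))^2"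
  shows "(\<Sum>i\<in>I. u (p i)) - (\<Sum>i\<in>I. u (q i)) \<le> (match_dist I p q)^2"
proof -
  obtain \<sigma> where \<sigma>: "\<sigma> permutes I" "match_dist I p q = L2_set (\<lambda>i. dist (p i) (q (\<sigma> i))) I"
    by (rule match_dist_attained[OF assms(1)])
  have "(\<Sum>i\<in>I. u (p i)) - (\<Sum>i\<in>I. u (q i)) = (\<Sum>i\<in>I. u (p i) - u (q (\<sigma> i)))"
    using sum.permute[OF \<sigma>(1), of "\<lambda>i. u (q i)"] by (simp add: sum_subtractf o_def)
  also have "\<dots> \<le> (\<Sum>i\<in>I. (dist (p i) (q (\<sigma> i)))^2)"
    using permutes_in_image[OF \<sigma>(1)] by (intro sum_mono u) auto
  also have "\<dots> = (match_dist I p q)^2"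
    by (simp add: \<sigma>(2) L2_set_def sum_nonneg)
  finally show ?thesis .
qed

section \<open>Point configurations for the torus\<close>

lemma finite_torus [simp]: "finite (torus n m)"
  by (simp add: torus_def finite_PiE)

lemma finite_signs [simp]: "finite (signs n)"
  by (simp add: signs_def finite_PiE)

lemma card_signs: "card (signs n) = 2^n"
  by (simp add: signs_def card_PiE numeral_2_eq_2)

lemma card_torus_pos: "m \<ge> 1 \<Longrightarrow> card (torus n m) > 0"
  by (simp add: torus_def card_PiE)

lemma tadd_torus: "m \<ge> 1 \<Longrightarrow> tadd n m x v \<in> torus n m"
  by (auto simp: torus_def tadd_def)

text \<open>The distance of \<open>k\<close> from 0 in the cycle of length \<open>2 * m\<close>.\<close>

definition circle_norm :: "nat \<Rightarrow> int \<Rightarrow> int" where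
  "circle_norm m k = min (k mod (2 * int m)) (2 * int m - k mod (2 * int m))"

lemma circle_norm_bounds: "m \<ge> 1 \<Longrightarrow> 0 \<le> circle_norm m k \<and> circle_norm m k \<le> 2 * int m"
  by (auto simp: circle_norm_def min_def intro: less_imp_le)

lemma circle_norm_mod: "circle_norm m (k mod (2 * int m) - l) = circle_norm m (k - l)"
  by (simp add: circle_norm_def mod_diff_left_eq)

lemma circle_norm_step:
  assumes "m \<ge> 1"
  shows "\<bar>circle_norm m (k + 1) - circle_norm m k\<bar> \<le> 1"
proof -
  define M where "M = 2 * int m"
  define r where "r = k mod M"
  have r: "0 \<le> r" "r < M" "M > 1" using assms by (auto simp: r_def M_def)
  have "(k + 1) mod M = (r + 1) mod M" by (simp add: r_def mod_add_left_eq)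
  also have "\<dots> = (if r + 1 = M then 0 else r + 1)" using r by auto
  finally show ?thesis using r
    by (auto simp: circle_norm_def M_def[symmetric] r_def[symmetric])
qed

lemma circle_norm_sign:
  assumes "m \<ge> 1" "e \<in> {-1, 1}"
  shows "\<bar>circle_norm m (k + e) - circle_norm m k\<bar> \<le> 1"
  using assms circle_norm_step[of m k] circle_norm_step[of m "k - 1"] by auto

text \<open>The edges of the graph are the pairs \<open>(x + \<epsilon>, x)\<close>. For the lower bound at \<open>x\<close> and \<open>j\<close> the function on
  the vertices is the circle norm of the \<open>j\<close>th coordinate relative to \<open>x\<close>, with value 0 at \<open>x\<close> and
  \<open>m\<close> at \<open>x + m e\<^sub>j\<close>.\<close>

lemma torus_configurations:
  fixes n m :: nat and \<delta> :: real
  assumes n: "n \<ge> 1" and m: "m \<ge> 1" and \<delta>: "\<delta> > 0"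
  obtains I :: "site set" and F :: "(nat \<Rightarrow> int) \<Rightarrow> site \<Rightarrow> real^3" and c :: real
  where "finite I" "I \<noteq> {}" "c > 0"
    and "\<And>x \<epsilon>. x \<in> torus n m \<Longrightarrow> \<epsilon> \<in> signs n \<Longrightarrow>
      \<exists>\<sigma>. \<sigma> permutes I \<and> (\<Sum>i\<in>I. (dist (F (tadd n m x \<epsilon>) i) (F x (\<sigma> i)))^2) \<le> (1 + \<delta>) * c"
    and "\<And>x j. x \<in> torus n m \<Longrightarrow> j \<in> {1..n} \<Longrightarrow>
      \<exists>u. (\<forall>i\<in>I. \<forall>i'\<in>I. u (F (tadd n m x (\<lambda>i. int m * unit_vec j i)) i) - u (F x i')
            \<le> (dist (F (tadd n m x (\<lambda>i. int m * unit_vec j i)) i) (F x i'))^2) \<and>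
        (\<Sum>i\<in>I. u (F (tadd n m x (\<lambda>i. int m * unit_vec j i)) i)) - (\<Sum>i\<in>I. u (F x i)) = c * real m"
proof -
  obtain \<nu> :: "(nat \<Rightarrow> int) \<Rightarrow> nat" and T0 where \<nu>: "\<nu> ` torus n m = {i. i < T0}" "inj_on \<nu> (torus n m)"
    using finite_imp_inj_to_nat_seg[OF finite_torus, of n m] by blast
  have \<nu>_le: "\<nu> x \<le> T0" if "x \<in> torus n m" for x
    using imageI[OF that, of \<nu>] unfolding \<nu>(1) by simp
  define E where "E = {(\<nu> (tadd n m x \<epsilon>), \<nu> x) | x \<epsilon>. x \<in> torus n m \<and> \<epsilon> \<in> signs n}"
  have E_sub: "E \<subseteq> {..T0} \<times> {..T0}"
    using \<nu>_le tadd_torus[OF m] by (auto simp: E_def)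
  have E_irrefl: "a \<noteq> b" if "(a, b) \<in> E" for a b
  proof
    assume "a = b"
    with that obtain x \<epsilon> where x: "x \<in> torus n m" "\<epsilon> \<in> signs n" "\<nu> (tadd n m x \<epsilon>) = \<nu> x"
      by (auto simp: E_def)
    hence "tadd n m x \<epsilon> = x" using \<nu>(2) tadd_torus[OF m] by (auto dest: inj_onD)
    hence "tadd n m x \<epsilon> 1 = x 1" by simp
    hence *: "(x 1 + \<epsilon> 1) mod (2 * int m) = x 1" using n by (simp add: tadd_def)
    have "x 1 mod (2 * int m) = x 1" "\<epsilon> 1 \<in> {-1, 1}"
      using x n by (auto simp: torus_def signs_def PiE_iff)
    with * have "(x 1 + \<epsilon> 1) mod (2 * int m) = x 1 mod (2 * int m)" by simp
    \<comment> \<open>There are no loops, as a step of \<open>\<plusminus> 1\<close> is not divisible by the even period.\<close>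
    hence "2 * int m dvd \<epsilon> 1" by (simp add: mod_eq_dvd_iff)
    with \<open>\<epsilon> 1 \<in> {-1, 1}\<close> have "2 * int m dvd 1" by auto
    thus False using m by (auto dest!: zdvd_imp_le)
  qed
  obtain I and F :: "nat \<Rightarrow> site \<Rightarrow> real^3" and c where
    I: "finite I" "I \<noteq> {}" "c > 0"
    and up: "\<And>a b. (a, b) \<in> E \<Longrightarrow>
      \<exists>\<sigma>. \<sigma> permutes I \<and> (\<Sum>i\<in>I. (dist (F a i) (F b (\<sigma> i)))^2) \<le> (1 + \<delta>) * c"
    and low: "\<And>\<phi>. \<forall>v\<le>T0. \<bar>\<phi> v\<bar> \<le> 2 * real m \<Longrightarrow> \<forall>(a, b)\<in>E. \<bar>\<phi> a - \<phi> b\<bar> \<le> 1 \<Longrightarrow>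
      \<exists>u. \<forall>x\<le>T0. \<forall>y\<le>T0. (\<forall>i\<in>I. \<forall>j\<in>I. u (F x i) - u (F y j) \<le> (dist (F x i) (F y j))^2) \<and>
        (\<Sum>i\<in>I. u (F x i)) - (\<Sum>i\<in>I. u (F y i)) = c * (\<phi> x - \<phi> y)"
    by (rule graph_snowflake[OF E_sub _ _ \<delta>, where \<Phi> = "2 * real m"])
      (rule E_irrefl, assumption, simp, rule that)
  show thesis
  proof (rule that[of I c "\<lambda>x. F (\<nu> x)"])
    show "finite I" "I \<noteq> {}" "c > 0" by fact+
  next
    fix x \<epsilon> assume "x \<in> torus n m" "\<epsilon> \<in> signs n"
    hence "(\<nu> (tadd n m x \<epsilon>), \<nu> x) \<in> E" by (auto simp: E_def)
    from up[OF this]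
    show "\<exists>\<sigma>. \<sigma> permutes I \<and> (\<Sum>i\<in>I. (dist (F (\<nu> (tadd n m x \<epsilon>)) i) (F (\<nu> x) (\<sigma> i)))^2) \<le> (1 + \<delta>) * c" .
  next
    fix x j assume x: "x \<in> torus n m" and j: "j \<in> {1..n}"
    define y where "y = tadd n m x (\<lambda>i. int m * unit_vec j i)"
    have y: "y \<in> torus n m" by (simp add: y_def tadd_torus[OF m])
    define \<phi> where "\<phi> v = (if v < T0 then real_of_int (circle_norm m (inv_into (torus n m) \<nu> v j - x j)) else 0)" for v
    have \<phi>_\<nu>: "\<phi> (\<nu> z) = real_of_int (circle_norm m (z j - x j))" if "z \<in> torus n m" for z
      using that \<nu> by (auto simp: \<phi>_def)
    have \<phi>1: "\<bar>\<phi> v\<bar> \<le> 2 * real m" for v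
    proof -
      have "real_of_int (circle_norm m k) \<ge> 0 \<and> real_of_int (circle_norm m k) \<le> real_of_int (2 * int m)" for k
        using circle_norm_bounds[OF m, of k] by (simp only: of_int_le_iff of_int_0_le_iff)
      thus ?thesis by (simp add: \<phi>_def)
    qed
    have \<phi>2: "\<forall>(a, b)\<in>E. \<bar>\<phi> a - \<phi> b\<bar> \<le> 1"
    proof clarify
      fix a b assume "(a, b) \<in> E"
      then obtain z \<epsilon> where z: "z \<in> torus n m" "\<epsilon> \<in> signs n" "a = \<nu> (tadd n m z \<epsilon>)" "b = \<nu> z"
        by (auto simp: E_def)
      have "tadd n m z \<epsilon> j = (z j + \<epsilon> j) mod (2 * int m)" using j by (simp add: tadd_def)
      hence "circle_norm m (tadd n m z \<epsilon> j - x j) = circle_norm m (z j - x j + \<epsilon> j)"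
        by (simp add: circle_norm_mod add_diff_eq diff_add_eq)
      moreover have "\<epsilon> j \<in> {-1, 1}" using z j by (auto simp: signs_def PiE_iff)
      ultimately have "\<bar>circle_norm m (tadd n m z \<epsilon> j - x j) - circle_norm m (z j - x j)\<bar> \<le> 1"
        using circle_norm_sign[OF m, of "\<epsilon> j" "z j - x j"] by simp
      thus "\<bar>\<phi> a - \<phi> b\<bar> \<le> 1" by (simp add: z \<phi>_\<nu> tadd_torus[OF m] flip: of_int_diff of_int_abs)
    qed
    have "y j = (x j + int m) mod (2 * int m)" using j by (simp add: y_def tadd_def unit_vec_def)
    hence "circle_norm m (y j - x j) = circle_norm m (int m)" by (simp add: circle_norm_mod)
    also have "\<dots> = int m" using m by (simp add: circle_norm_def)
    finally have "\<phi> (\<nu> y) - \<phi> (\<nu> x) = real m"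
      using m by (simp add: \<phi>_\<nu> x y circle_norm_def[of m 0])
    with low[OF _ \<phi>2] \<phi>1 \<nu>_le[OF x] \<nu>_le[OF y]
    show "\<exists>u. (\<forall>i\<in>I. \<forall>i'\<in>I. u (F (\<nu> (tadd n m x (\<lambda>i. int m * unit_vec j i))) i) - u (F (\<nu> x) i')
            \<le> (dist (F (\<nu> (tadd n m x (\<lambda>i. int m * unit_vec j i))) i) (F (\<nu> x) i'))^2) \<and>
        (\<Sum>i\<in>I. u (F (\<nu> (tadd n m x (\<lambda>i. int m * unit_vec j i))) i)) - (\<Sum>i\<in>I. u (F (\<nu> x) i)) = c * real m"
      unfolding y_def by metis
  qed
qed

section \<open>Lower bounds for the cotype constants\<close>

text \<open>Summing the two-sided bounds over the torus turns the cotype inequality into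
  \<open>n * (c * m) \<le> K * m\<^sup>2 * ((1 + \<delta>) * c)\<close>, in which \<open>c\<close> cancels.\<close>

lemma cotype_constant_ge:
  fixes d :: "'x \<Rightarrow> 'x \<Rightarrow> real" and K c \<delta> :: real
  assumes m: "m \<ge> 1" and K: "K \<ge> 0" and c: "c > 0"
    and diag: "\<And>x \<epsilon>. x \<in> torus n m \<Longrightarrow> \<epsilon> \<in> signs n \<Longrightarrow> (d (f (tadd n m x \<epsilon>)) (f x))^2 \<le> (1 + \<delta>) * c"
    and anti: "\<And>x j. x \<in> torus n m \<Longrightarrow> j \<in> {1..n} \<Longrightarrow>
      c * real m \<le> (d (f (tadd n m x (\<lambda>i. int m * unit_vec j i))) (f x))^2"
    and cotype: "antipodal_sum n m d f \<le> K * (real m)^2 * diagonal_average n m d f"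
  shows "real n \<le> K * real m * (1 + \<delta>)"
proof -
  define N where "N = real (card (torus n m))"
  have N: "N > 0" using card_torus_pos[OF m] by (simp add: N_def)
  have "real n * (N * (c * real m)) = (\<Sum>j\<in>{1..n}. \<Sum>x\<in>torus n m. c * real m)"
    by (simp add: N_def)
  also have "\<dots> \<le> antipodal_sum n m d f"
    unfolding antipodal_sum_def by (intro sum_mono anti)
  also have "\<dots> \<le> K * (real m)^2 * diagonal_average n m d f" by (rule cotype)
  also have "diagonal_average n m d f \<le> 1 / 2^n * (\<Sum>\<epsilon>\<in>signs n. \<Sum>x\<in>torus n m. (1 + \<delta>) * c)"
    unfolding diagonal_average_def by (intro mult_left_mono sum_mono diag) auto
  hence "K * (real m)^2 * diagonal_average n m d f
      \<le> K * (real m)^2 * (1 / 2^n * (\<Sum>\<epsilon>\<in>signs n. \<Sum>x\<in>torus n m. (1 + \<delta>) * c))"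
    using K by (intro mult_left_mono) auto
  also have "\<dots> = (K * real m * (1 + \<delta>)) * (N * (c * real m))"
    by (simp add: N_def card_signs power2_eq_square)
  finally show ?thesis
    using N c m by (simp add: mult_ac)
qed

lemma le_of_le_one_plus:
  fixes a b :: real
  assumes "b > 0" "\<And>\<delta>. \<delta> > 0 \<Longrightarrow> a \<le> b * (1 + \<delta>)"
  shows "a \<le> b"
proof (rule field_le_epsilon)
  fix e :: real assume "e > 0"
  thus "a \<le> b + e" using assms(2)[of "e / b"] assms(1) by (simp add: distrib_left)
qed

lemma wasserstein_cotype_ge:
  assumes n: "n \<ge> 1" and m: "m \<ge> 1" and \<Gamma>: "\<Gamma> > 0"
    and cotype: "\<forall>f \<in> torus n m \<rightarrow> (P2 :: (real^3) measure set).
               sqrt (antipodal_sum n m W2 f) \<le> \<Gamma> * real m * sqrt (diagonal_average n m W2 f)"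
  shows "real m \<ge> real n / \<Gamma>^2"
proof -
  have "real n \<le> \<Gamma>^2 * real m"
  proof (rule le_of_le_one_plus)
    fix \<delta> :: real assume "\<delta> > 0"
    obtain I :: "site set" and F :: "(nat \<Rightarrow> int) \<Rightarrow> site \<Rightarrow> real^3" and c where
      I: "finite I" "I \<noteq> {}" "c > 0"
      and up: "\<And>x \<epsilon>. x \<in> torus n m \<Longrightarrow> \<epsilon> \<in> signs n \<Longrightarrow>
        \<exists>\<sigma>. \<sigma> permutes I \<and> (\<Sum>i\<in>I. (dist (F (tadd n m x \<epsilon>) i) (F x (\<sigma> i)))^2) \<le> (1 + \<delta>) * c"
      and low: "\<And>x j. x \<in> torus n m \<Longrightarrow> j \<in> {1..n} \<Longrightarrow>
        \<exists>u. (\<forall>i\<in>I. \<forall>i'\<in>I. u (F (tadd n m x (\<lambda>i. int m * unit_vec j i)) i) - u (F x i')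
              \<le> (dist (F (tadd n m x (\<lambda>i. int m * unit_vec j i)) i) (F x i'))^2) \<and>
          (\<Sum>i\<in>I. u (F (tadd n m x (\<lambda>i. int m * unit_vec j i)) i)) - (\<Sum>i\<in>I. u (F x i)) = c * real m"
      by (rule torus_configurations[OF n m \<open>\<delta> > 0\<close>]) (rule that)
    define f where "f x = uniform_on I (F x)" for x
    have card: "real (card I) > 0" using I by (simp add: card_gt_0_iff)
    show "real n \<le> \<Gamma>^2 * real m * (1 + \<delta>)"
    proof (rule cotype_constant_ge[OF m])
      show "\<Gamma>^2 \<ge> 0" "c / card I > 0" using card I by auto
    next
      fix x \<epsilon> assume "x \<in> torus n m" "\<epsilon> \<in> signs n"
      then obtain \<sigma> where \<sigma>: "\<sigma> permutes I" "(\<Sum>i\<in>I. (dist (F (tadd n m x \<epsilon>) i) (F x (\<sigma> i)))^2) \<le> (1 + \<delta>) * c"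
        using up by blast
      have "(W2 (f (tadd n m x \<epsilon>)) (f x))^2 \<le> (\<Sum>i\<in>I. (dist (F (tadd n m x \<epsilon>) i) (F x (\<sigma> i)))^2) / card I"
        unfolding f_def by (rule W2_uniform_on_le[OF I(1,2) \<sigma>(1)])
      also have "\<dots> \<le> (1 + \<delta>) * c / card I" by (intro divide_right_mono \<sigma>) auto
      finally show "(W2 (f (tadd n m x \<epsilon>)) (f x))^2 \<le> (1 + \<delta>) * (c / card I)" by simp
    next
      fix x j assume "x \<in> torus n m" "j \<in> {1..n}"
      from low[OF this] obtain u where
        u: "\<And>i i'. i \<in> I \<Longrightarrow> i' \<in> I \<Longrightarrow> u (F (tadd n m x (\<lambda>i. int m * unit_vec j i)) i) - u (F x i')
              \<le> (dist (F (tadd n m x (\<lambda>i. int m * unit_vec j i)) i) (F x i'))^2"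
          "(\<Sum>i\<in>I. u (F (tadd n m x (\<lambda>i. int m * unit_vec j i)) i)) - (\<Sum>i\<in>I. u (F x i)) = c * real m"
        by blast
      from W2_uniform_on_ge[OF I(1,2), of u "F (tadd n m x (\<lambda>i. int m * unit_vec j i))" "F x"] u
      show "c / card I * real m \<le> (W2 (f (tadd n m x (\<lambda>i. int m * unit_vec j i))) (f x))^2"
        by (simp add: f_def)
    next
      have "f \<in> torus n m \<rightarrow> P2" using uniform_on_P2[OF I(1,2)] by (auto simp: f_def)
      with cotype have "sqrt (antipodal_sum n m W2 f) \<le> \<Gamma> * real m * sqrt (diagonal_average n m W2 f)" by blast
      hence "(sqrt (antipodal_sum n m W2 f))^2 \<le> (\<Gamma> * real m * sqrt (diagonal_average n m W2 f))^2"
        by (intro power_mono) (auto simp: antipodal_sum_def sum_nonneg)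
      thus "antipodal_sum n m W2 f \<le> \<Gamma>^2 * (real m)^2 * diagonal_average n m W2 f"
        by (simp add: power_mult_distrib antipodal_sum_def diagonal_average_def sum_nonneg)
    qed
  qed (use \<Gamma> m in auto)
  thus ?thesis using \<Gamma> by (simp add: divide_le_eq mult.commute)
qed

lemma CBB0_cotype_ge:
  assumes card: "(UNIV :: real set) \<lesssim> (UNIV :: 'a set)" and n: "n \<ge> 1" and m: "m \<ge> 1" and K: "K > 0"
    and cotype: "\<And>(X :: 'a set) d f. complete_CBB0 X d \<Longrightarrow> f \<in> torus n m \<rightarrow> X \<Longrightarrow>
        antipodal_sum n m d f \<le> K * (real m)^2 * diagonal_average n m d f"
  shows "real n \<le> K * real m"
proof (rule le_of_le_one_plus)
  fix \<delta> :: real assume "\<delta> > 0"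
  obtain I :: "site set" and F :: "(nat \<Rightarrow> int) \<Rightarrow> site \<Rightarrow> real^3" and c where
    I: "finite I" "I \<noteq> {}" "c > 0"
    and up: "\<And>x \<epsilon>. x \<in> torus n m \<Longrightarrow> \<epsilon> \<in> signs n \<Longrightarrow>
      \<exists>\<sigma>. \<sigma> permutes I \<and> (\<Sum>i\<in>I. (dist (F (tadd n m x \<epsilon>) i) (F x (\<sigma> i)))^2) \<le> (1 + \<delta>) * c"
    and low: "\<And>x j. x \<in> torus n m \<Longrightarrow> j \<in> {1..n} \<Longrightarrow>
      \<exists>u. (\<forall>i\<in>I. \<forall>i'\<in>I. u (F (tadd n m x (\<lambda>i. int m * unit_vec j i)) i) - u (F x i')
            \<le> (dist (F (tadd n m x (\<lambda>i. int m * unit_vec j i)) i) (F x i'))^2) \<and>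
        (\<Sum>i\<in>I. u (F (tadd n m x (\<lambda>i. int m * unit_vec j i)) i)) - (\<Sum>i\<in>I. u (F x i)) = c * real m"
    by (rule torus_configurations[OF n m \<open>\<delta> > 0\<close>]) (rule that)
  obtain g :: "(site \<Rightarrow> real^3) \<Rightarrow> 'a" and d
    where X: "complete_CBB0 (range g) d" and d: "\<And>p q. d (g p) (g q) = match_dist I p q"
    by (rule match_dist_realisation[OF I(1) card]) blast
  show "real n \<le> K * real m * (1 + \<delta>)"
  proof (rule cotype_constant_ge[OF m _ I(3), where d = d and f = "\<lambda>x. g (F x)"])
    show "K \<ge> 0" using K by simp
  next
    fix x \<epsilon> assume "x \<in> torus n m" "\<epsilon> \<in> signs n"
    then obtain \<sigma> where "\<sigma> permutes I" "(\<Sum>i\<in>I. (dist (F (tadd n m x \<epsilon>) i) (F x (\<sigma> i)))^2) \<le> (1 + \<delta>) * c"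
      using up by blast
    thus "(d (g (F (tadd n m x \<epsilon>))) (g (F x)))^2 \<le> (1 + \<delta>) * c"
      unfolding d by (rule order_trans[OF match_dist_sq_le[OF I(1)]])
  next
    fix x j assume "x \<in> torus n m" "j \<in> {1..n}"
    from low[OF this] show "c * real m \<le> (d (g (F (tadd n m x (\<lambda>i. int m * unit_vec j i)))) (g (F x)))^2"
      unfolding d using match_dist_sq_ge[OF I(1)] by metis
  next
    show "antipodal_sum n m d (\<lambda>x. g (F x)) \<le> K * (real m)^2 * diagonal_average n m d (\<lambda>x. g (F x))"
      by (rule cotype[OF X]) auto
  qed
qed (use K m in auto)

theorem proposition2p3:
  shows "(\<forall>(n::nat) (m::nat) (\<Gamma>::real). n \<ge> 1 \<and> m \<ge> 1 \<and> \<Gamma> > 0 \<and>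
            (\<forall>f \<in> torus n m \<rightarrow> (P2 :: (real^3) measure set).
               sqrt (antipodal_sum n m W2 f) \<le> \<Gamma> * real m * sqrt (diagonal_average n m W2 f))
            \<longrightarrow> real m \<ge> real n / \<Gamma>^2)
       \<and> ((UNIV :: real set) \<lesssim> (UNIV :: 'a set) \<longrightarrow>
            (\<forall>(n::nat) (m::nat). n \<ge> 1 \<and> m \<ge> 1 \<longrightarrow>
               K_CBB0 TYPE('a) n m \<ge> ereal (real n / real m)))"
proof (intro conjI allI impI)
  fix n m :: nat and \<Gamma> :: real
  assume "n \<ge> 1 \<and> m \<ge> 1 \<and> \<Gamma> > 0 \<and>
            (\<forall>f \<in> torus n m \<rightarrow> (P2 :: (real^3) measure set).
               sqrt (antipodal_sum n m W2 f) \<le> \<Gamma> * real m * sqrt (diagonal_average n m W2 f))"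
  thus "real m \<ge> real n / \<Gamma>^2" by (intro wasserstein_cotype_ge) auto
next
  fix n m :: nat
  assume card: "(UNIV :: real set) \<lesssim> (UNIV :: 'a set)" and nm: "n \<ge> 1 \<and> m \<ge> 1"
  show "K_CBB0 TYPE('a) n m \<ge> ereal (real n / real m)"
    unfolding K_CBB0_def
  proof (rule Inf_greatest, clarify)
    fix K :: real
    assume "K > 0" and "\<forall>(X :: 'a set) d f. complete_CBB0 X d \<and> f \<in> torus n m \<rightarrow> X \<longrightarrow>
        antipodal_sum n m d f \<le> K * (real m)^2 * diagonal_average n m d f"
    hence "real n \<le> K * real m"
      using nm by (intro CBB0_cotype_ge[OF card]) blast+
    thus "ereal (real n / real m) \<le> ereal K"
      using nm by (simp add: divide_le_eq)
  qed
qed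

end
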